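(* The map $\vartheta$ is diagonalizable on $\Pi$. A complete set of eigenvectors is given by $\Omega_w=\widehat{w}(\Theta_{\mathbf 1})$, where $w$ ranges over all $\mathbf{c}\mathbf{d}$-words; that is, for each $n\ge0$, the elements $\Omega_w$ with $\deg w=n$ form a basis of $\Pi_{n+1}$ consisting of eigenvectors of $\vartheta$. The eigenvalue corresponding to $\Omega_w$ is $2^{|w|_{\mathbf c}+1}$, and so, on $\Pi_{n+1}$, the eigenvalues of $\vartheta$ are $2^{n+1-2k}$, $0\le k\le\lfloor n/2\rfloor$.
   Context: Let $\mathcal{Q}$ be the algebra of quasisymmetric functions over $\mathbb{Q}$ in $x_1,x_2,\dots$: the linear span of $M_0=1$ and $M_\beta=\sum_{i_1<\cdots<i_k}x_{i_1}^{\beta_1}\cdots x_{i_k}^{\beta_k}$ for compositions $\beta=(\beta_1,\dots,\beta_k)$; $\mathcal{Q}_m$ is its degree-$m$ homogeneous part. Put $[n]=\{1,\dots,n\}$, $[0]=\emptyset$. For $n\ge0$, $S=\{i_1<\dots<i_k\}\subset[n]$ let $M_S=M_S^{(n+1)}=M_{(i_1,i_2-i_1,\dots,i_k-i_{k-1},n+1-i_k)}\in\mathcal{Q}_{n+1}$ (with $M^{(n+1)}_\emptyset=M_{(n+1)}$) and $F_S=F_S^{(n+1)}=\sum_{S\subset T\subset[n]}M_T^{(n+1)}$; each family is a basis of $\mathcal{Q}_{n+1}$. $S\subset[n]$ is left sparse if $1\notin S$ and $i\in S\Rightarrow i-1\notin S$. For such $S$, $\Theta_S=\Theta_S^{(n+1)}=\sum_{T\subset[n]:\,S\subset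 T\cup(T+1)}2^{|T|+1}M_T^{(n+1)}$, where $T+1=\{i+1:i\in T\}$. The peak algebra $\Pi$ is the subalgebra of $\mathcal{Q}$ generated by all these $\Theta_S$ ($n\ge0$), and $\Pi_m=\Pi\cap\mathcal{Q}_m$. $\Theta_{\mathbf 1}=2M^{(1)}_\emptyset=2M_{(1)}$. For $S\subset[n]$, $\Lambda(S)=\{i\in S: i\ne1,\ i-1\notin S\}$. The map $\vartheta:\mathcal{Q}\to\Pi$ is the linear map with $\vartheta(1)=1$ and $\vartheta(F_S^{(n+1)})=\Theta_{\Lambda(S)}^{(n+1)}$ for $S\subset[n]$, $n\ge0$ (it is an algebra map). $L$ is the linear map on elements of positive degree defined by $L(M_S^{(n)})=M_S^{(n+1)}$ for $n\ge1$, $S\subset[n-1]$; $L^2=L\circ L$ (which maps $\Pi_n$ into $\Pi_{n+2}$). A $\mathbf{c}\mathbf{d}$-word is a (possibly empty) word in noncommuting letters $\mathbf{c},\mathbf{d}$ of degrees 1 and 2; $|w|_{\mathbf c}$ is the number of $\mathbf c$'s in $w$. For a word $w=w(\mathbf c,\mathbf d)$, $\widehat{w}=w(\Theta_{\mathbf 1},L^2)$ is the operator obtained by replacing each $\mathbf c$ by the operator of multiplication by $\Theta_{\mathbf 1}$, each $\mathbf d$ by $L^2$, and concatenation by composition (e.g. $\widehat{\mathbf{c}\mathbf{d}\mathbf{c}}=\Theta_{\mathbf 1}\circ L^2\circ\Theta_{\mathbf 1}$); the empty word gives the identity. *)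

theory Defs
  imports Complex_Main "HOL-Library.Poly_Mapping"
begin

section \<open>Formal power series over the rationals in countably many variables\<close>

text \<open>
  A monomial is its exponent vector, a finitely supported function \<^typ>\<open>nat \<Rightarrow>\<^sub>0 nat\<close>;
  index \<open>i\<close> stands for the variable $x_{i+1}$, since only the order of the variables matters.
\<close>

typedef series = "UNIV :: ((nat \<Rightarrow>\<^sub>0 nat) \<Rightarrow> rat) set"
  morphisms coeff Series
  by simp

lemma coeff_Series [simp]: "coeff (Series f) = f"
  by (simp add: Series_inverse)

lemma series_eqI: "(\<And>m. coeff f m = coeff g m) \<Longrightarrow> f = g"
  using coeff_inject by blast

lemma finite_splittings: "finite {(a, b). a + b = (m :: nat \<Rightarrow>\<^sub>0 nat)}"
proof -
  define B where "B = (\<Sum>i\<in>Poly_Mapping.keys m. Poly_Mapping.lookup m i)"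
  define X where "X = {h :: nat \<Rightarrow> nat. \<forall>i. (i \<in> Poly_Mapping.keys m \<longrightarrow> h i \<in> {..B}) \<and>
    (i \<notin> Poly_Mapping.keys m \<longrightarrow> h i = 0)}"
  have "finite X"
    unfolding X_def by (rule finite_set_of_finite_funs) auto
  have le: "Poly_Mapping.lookup a i \<le> Poly_Mapping.lookup m i" if "a + b = m" for a b i
    using that by (auto simp: lookup_add)
  have mB: "Poly_Mapping.lookup m i \<le> B" if "i \<in> Poly_Mapping.keys m" for i
    unfolding B_def using that by (intro member_le_sum) auto
  have "Poly_Mapping.lookup a \<in> X" if "a + b = m" for a b
    unfolding X_def using le[OF that] mB
    by (auto simp: in_keys_iff) (metis le_trans, metis le_zero_eq)
  hence "(\<lambda>p. Poly_Mapping.lookup (fst p)) ` {(a, b). a + b = m} \<subseteq> X"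
    by auto
  hence "finite ((\<lambda>p. Poly_Mapping.lookup (fst p)) ` {(a, b). a + b = m})"
    using \<open>finite X\<close> finite_subset by blast
  moreover have "inj_on (\<lambda>p. Poly_Mapping.lookup (fst p)) {(a, b). a + b = m}"
    by (auto simp: inj_on_def lookup_inject)
  ultimately show ?thesis
    by (rule finite_imageD)
qed

instantiation series :: comm_ring_1
begin

definition "0 = Series (\<lambda>m. 0)"
definition "1 = Series (\<lambda>m. if m = 0 then 1 else 0)"
definition "f + g = Series (\<lambda>m. coeff f m + coeff g m)"
definition "- f = Series (\<lambda>m. - coeff f m)" for f :: series
definition "f - g = Series (\<lambda>m. coeff f m - coeff g m)"
definition "f * g = Series (\<lambda>m. \<Sum>(a, b) | a + b = m. coeff f a * coeff g b)"

lemma coeff_simps [simp]: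
  "coeff 0 m = 0" "coeff 1 m = (if m = 0 then 1 else 0)"
  "coeff (f + g) m = coeff f m + coeff g m"
  "coeff (- f) m = - coeff f m"
  "coeff (f - g) m = coeff f m - coeff g m"
  by (simp_all add: zero_series_def one_series_def plus_series_def uminus_series_def
      minus_series_def)

lemma coeff_mult: "coeff (f * g) m = (\<Sum>(a, b) | a + b = m. coeff f a * coeff g b)"
  by (simp add: times_series_def)

instance
proof
  fix f g h :: series
  show "f + g + h = f + (g + h)" "f + g = g + f" "0 + f = f" "- f + f = 0" "f - g = f + - g"
    by (rule series_eqI; simp)+
  show "(0 :: series) \<noteq> 1"
    by (metis coeff_simps(1,2) zero_neq_one)
  show "f * g = g * f"
  proof (rule series_eqI)
    fix m
    show "coeff (f * g) m = coeff (g * f) m"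
      unfolding coeff_mult
      by (rule sum.reindex_bij_witness[of _ prod.swap prod.swap])
         (auto simp: add.commute mult.commute)
  qed
  show "(f + g) * h = f * h + g * h"
    by (rule series_eqI) (simp add: coeff_mult case_prod_unfold distrib_right sum.distrib)
  show "1 * f = f"
  proof (rule series_eqI)
    fix m
    have "coeff (1 * f) m = (\<Sum>p\<in>{(a, b). a + b = m}. if p = (0, m) then coeff f m else 0)"
      unfolding coeff_mult by (intro sum.cong) (auto split: if_splits)
    thus "coeff (1 * f) m = coeff f m"
      by (simp add: finite_splittings)
  qed
  show "f * g * h = f * (g * h)"
  proof (rule series_eqI)
    fix m
    have "coeff (f * g * h) m =
        (\<Sum>p\<in>{(a, b). a + b = m}. \<Sum>q\<in>{(a, b). a + b = fst p}.
           coeff f (fst q) * coeff g (snd q) * coeff h (snd p))"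
      by (simp add: coeff_mult case_prod_unfold sum_distrib_right)
    also have "\<dots> = (\<Sum>(p, q)\<in>(SIGMA p:{(a, b). a + b = m}. {(a, b). a + b = fst p}).
           coeff f (fst q) * coeff g (snd q) * coeff h (snd p))"
      by (rule sum.Sigma) (auto simp: finite_splittings)
    also have "\<dots> = (\<Sum>(p, q)\<in>(SIGMA p:{(a, b). a + b = m}. {(a, b). a + b = snd p}).
           coeff f (fst p) * (coeff g (fst q) * coeff h (snd q)))"
      by (rule sum.reindex_bij_witness[of _
            "\<lambda>(p, q). ((fst p + fst q, snd q), (fst p, fst q))"
            "\<lambda>(p, q). ((fst q, snd q + snd p), (snd q, snd p))"])
         (auto simp: add.assoc mult.assoc)
    also have "\<dots> = (\<Sum>p\<in>{(a, b). a + b = m}. \<Sum>q\<in>{(a, b). a + b = snd p}.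
           coeff f (fst p) * (coeff g (fst q) * coeff h (snd q)))"
      by (rule sum.Sigma [symmetric]) (auto simp: finite_splittings)
    also have "\<dots> = coeff (f * (g * h)) m"
      by (simp add: coeff_mult case_prod_unfold sum_distrib_left)
    finally show "coeff (f * g * h) m = coeff (f * (g * h)) m" .
  qed
qed

end

definition scale :: "rat \<Rightarrow> series \<Rightarrow> series"
  where "scale c f = Series (\<lambda>m. c * coeff f m)"

lemma coeff_scale [simp]: "coeff (scale c f) m = c * coeff f m"
  by (simp add: scale_def)

lemma coeff_sum: "coeff (sum f A) m = (\<Sum>a\<in>A. coeff (f a) m)"
  by (induction A rule: infinite_finite_induct) auto

global_interpretation qs: vector_space scale
  by unfold_locales (rule series_eqI; simp add: algebra_simps)+

global_interpretation qs_pair: vector_space_pair scale scale ..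

abbreviation linear_map :: "(series \<Rightarrow> series) \<Rightarrow> bool"
  where "linear_map \<equiv> Vector_Spaces.linear scale scale"


section \<open>Quasisymmetric functions\<close>

definition is_composition :: "nat list \<Rightarrow> bool"
  where "is_composition \<beta> \<longleftrightarrow> (\<forall>b\<in>set \<beta>. 0 < b)"

text \<open>
  $M_\beta$ is the sum of the monomials \<open>quasi_monom is \<beta>\<close> over all strictly increasing index
  sequences \<open>is\<close> of the length of \<open>\<beta>\<close>. For a composition \<open>\<beta>\<close> distinct sequences give distinct
  monomials, so all coefficients are 0 or 1.
\<close>

definition quasi_monom :: "nat list \<Rightarrow> nat list \<Rightarrow> (nat \<Rightarrow>\<^sub>0 nat)"
  where "quasi_monom is \<beta> = sum_list (map2 Poly_Mapping.single is \<beta>)"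

definition M :: "nat list \<Rightarrow> series"
  where "M \<beta> = Series (\<lambda>m.
    if \<exists>is. sorted_wrt (<) is \<and> length is = length \<beta> \<and> m = quasi_monom is \<beta> then 1 else 0)"

definition QSym :: "series set"
  where "QSym = qs.span (M ` {\<beta>. is_composition \<beta>})"

definition mdeg :: "(nat \<Rightarrow>\<^sub>0 nat) \<Rightarrow> nat"
  where "mdeg m = (\<Sum>i\<in>Poly_Mapping.keys m. Poly_Mapping.lookup m i)"

definition homogeneous :: "nat \<Rightarrow> series \<Rightarrow> bool"
  where "homogeneous d f \<longleftrightarrow> (\<forall>m. coeff f m \<noteq> 0 \<longrightarrow> mdeg m = d)"

definition QSym_part :: "nat \<Rightarrow> series set"
  where "QSym_part d = {f \<in> QSym. homogeneous d f}"

fun gaps :: "nat \<Rightarrow> nat list \<Rightarrow> nat list" where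
  "gaps a [] = []"
| "gaps a (y # ys) = (y - a) # gaps y ys"

text \<open>
  In \<open>composition_of\<close>, \<open>MS\<close>, \<open>FS\<close> and \<open>\<Theta>\<close> the first argument is \<open>n\<close>, the sets are subsets
  of $[n]$ and the result lives in degree $n+1$: \<open>MS n S\<close> is $M_S^{(n+1)}$, and so on.
\<close>

definition composition_of :: "nat \<Rightarrow> nat set \<Rightarrow> nat list"
  where "composition_of n S = gaps 0 (sorted_list_of_set S @ [n + 1])"

definition MS :: "nat \<Rightarrow> nat set \<Rightarrow> series"
  where "MS n S = M (composition_of n S)"

definition FS :: "nat \<Rightarrow> nat set \<Rightarrow> series"
  where "FS n S = (\<Sum>T | S \<subseteq> T \<and> T \<subseteq> {1..n}. MS n T)"


section \<open>The peak algebra\<close>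

definition left_sparse :: "nat \<Rightarrow> nat set \<Rightarrow> bool"
  where "left_sparse n S \<longleftrightarrow> S \<subseteq> {1..n} \<and> 1 \<notin> S \<and> (\<forall>i\<in>S. i - 1 \<notin> S)"

definition \<Theta> :: "nat \<Rightarrow> nat set \<Rightarrow> series"
  where "\<Theta> n S = (\<Sum>T | T \<subseteq> {1..n} \<and> S \<subseteq> T \<union> (\<lambda>i. i + 1) ` T. scale (2 ^ (card T + 1)) (MS n T))"

definition subalgebra :: "series set \<Rightarrow> bool"
  where "subalgebra A \<longleftrightarrow> qs.subspace A \<and> 1 \<in> A \<and> (\<forall>f\<in>A. \<forall>g\<in>A. f * g \<in> A)"

definition Peak :: "series set"
  where "Peak = subalgebra hull {\<Theta> n S | n S. left_sparse n S}"

definition Peak_part :: "nat \<Rightarrow> series set"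
  where "Peak_part d = Peak \<inter> QSym_part d"

definition \<Theta>\<^sub>1 :: series
  where "\<Theta>\<^sub>1 = scale 2 (MS 0 {})"

definition \<Lambda> :: "nat set \<Rightarrow> nat set"
  where "\<Lambda> S = {i \<in> S. i \<noteq> 1 \<and> i - 1 \<notin> S}"


section \<open>The maps theta and L\<close>

text \<open>
  Both maps are prescribed on a basis of a subspace of \<^typ>\<open>series\<close> (all of \<^term>\<open>QSym\<close>, and its
  elements of positive degree, respectively). They are taken to be some linear maps on all series
  with the prescribed values; existence, and uniqueness on the intended domains, are proved below.
\<close>

definition is_\<theta> :: "(series \<Rightarrow> series) \<Rightarrow> bool"
  where "is_\<theta> h \<longleftrightarrow> linear_map h \<and> h 1 = 1 \<and> (\<forall>n S. S \<subseteq> {1..n} \<longrightarrow> h (FS n S) = \<Theta> n (\<Lambda> S))"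

definition \<theta> :: "series \<Rightarrow> series"
  where "\<theta> = (SOME h. is_\<theta> h)"

definition is_L :: "(series \<Rightarrow> series) \<Rightarrow> bool"
  where "is_L h \<longleftrightarrow> linear_map h \<and> (\<forall>n S. S \<subseteq> {1..n} \<longrightarrow> h (MS n S) = MS (n + 1) S)"

definition L :: "series \<Rightarrow> series"
  where "L = (SOME h. is_L h)"

lemma lookup_quasi_monom_notin:
  "k \<notin> set is \<Longrightarrow> Poly_Mapping.lookup (quasi_monom is \<beta>) k = 0"
proof (induction "is" arbitrary: \<beta>)
  case (Cons i "is")
  thus ?case by (cases \<beta>) (auto simp: quasi_monom_def lookup_add lookup_single)
qed (simp add: quasi_monom_def)

lemma map_lookup_quasi_monom:
  assumes "distinct is" "length is = length \<beta>"
  shows "map (Poly_Mapping.lookup (quasi_monom is \<beta>)) is = \<beta>"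
  using assms
proof (induction "is" arbitrary: \<beta>)
  case (Cons i "is")
  then obtain b \<gamma> where \<beta>: "\<beta> = b # \<gamma>" by (cases \<beta>) auto
  have eq: "quasi_monom (i # is) \<beta> = Poly_Mapping.single i b + quasi_monom is \<gamma>"
    by (simp add: quasi_monom_def \<beta>)
  have "map (Poly_Mapping.lookup (quasi_monom (i # is) \<beta>)) is =
      map (Poly_Mapping.lookup (quasi_monom is \<gamma>)) is"
    using Cons.prems by (auto simp: eq lookup_add lookup_single when_def)
  also have "\<dots> = \<gamma>" using Cons \<beta> by simp
  finally have "map (Poly_Mapping.lookup (quasi_monom (i # is) \<beta>)) is = \<gamma>" .
  moreover have "Poly_Mapping.lookup (quasi_monom (i # is) \<beta>) i = b"
    using Cons.prems(1) lookup_quasi_monom_notin[of i "is" \<gamma>] by (simp add: eq lookup_add)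
  ultimately show ?case unfolding \<beta> by simp
qed simp

lemma quasi_monom_unique:
  assumes "sorted_wrt (<) is" "length is = length \<beta>" "is_composition \<beta>"
  shows "\<beta> = map (Poly_Mapping.lookup (quasi_monom is \<beta>))
           (sorted_list_of_set (Poly_Mapping.keys (quasi_monom is \<beta>)))"
proof -
  have d: "distinct is" "sorted is"
    using assms(1) strict_sorted_iff by auto
  note m = map_lookup_quasi_monom[OF d(1) assms(2)]
  have "Poly_Mapping.keys (quasi_monom is \<beta>) = set is"
  proof (intro set_eqI iffI)
    fix k assume "k \<in> set is"
    hence "Poly_Mapping.lookup (quasi_monom is \<beta>) k \<in> set \<beta>"
      using m by (metis image_eqI list.set_map)
    thus "k \<in> Poly_Mapping.keys (quasi_monom is \<beta>)"
      using assms(3) by (auto simp: is_composition_def in_keys_iff)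
  qed (metis in_keys_iff lookup_quasi_monom_notin)
  thus ?thesis
    using m d by (metis sorted_list_of_set.idem_if_sorted_distinct)
qed

lemma coeff_M_self: "coeff (M \<beta>) (quasi_monom [0..<length \<beta>] \<beta>) = 1"
  by (auto simp: M_def intro!: exI[of _ "[0..<length \<beta>]"] simp: sorted_wrt_upt)

lemma coeff_M_other:
  assumes "is_composition \<beta>" "is_composition \<gamma>" "\<beta> \<noteq> \<gamma>"
  shows "coeff (M \<gamma>) (quasi_monom [0..<length \<beta>] \<beta>) = 0"
proof (rule ccontr)
  assume "\<not> ?thesis"
  then obtain "is" where "sorted_wrt (<) is" "length is = length \<gamma>"
    "quasi_monom [0..<length \<beta>] \<beta> = quasi_monom is \<gamma>"
    by (auto simp: M_def split: if_splits)
  with quasi_monom_unique[of "[0..<length \<beta>]" \<beta>] quasi_monom_unique[of "is" \<gamma>] assms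
  show False by (simp add: sorted_wrt_upt)
qed

lemma M_inject: "is_composition \<beta> \<Longrightarrow> is_composition \<gamma> \<Longrightarrow> M \<beta> = M \<gamma> \<Longrightarrow> \<beta> = \<gamma>"
  using coeff_M_self[of \<beta>] coeff_M_other[of \<beta> \<gamma>] by auto

lemma M_Nil: "M [] = 1"
  by (rule series_eqI) (simp add: M_def quasi_monom_def)

lemma independent_M: "qs.independent (M ` {\<beta>. is_composition \<beta>})"
  unfolding qs.independent_explicit_module
proof (intro allI impI)
  fix t u v
  assume t: "finite t" "t \<subseteq> M ` {\<beta>. is_composition \<beta>}"
    and 0: "(\<Sum>v\<in>t. scale (u v) v) = 0" and v: "v \<in> t"
  from v t obtain \<beta> where \<beta>: "is_composition \<beta>" "v = M \<beta>" by auto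
  let ?m = "quasi_monom [0..<length \<beta>] \<beta>"
  have "0 = coeff (\<Sum>v\<in>t. scale (u v) v) ?m" using 0 by simp
  also have "\<dots> = (\<Sum>w\<in>t. u w * coeff w ?m)" by (simp add: coeff_sum)
  also have "\<dots> = (\<Sum>w\<in>t. if w = v then u v else 0)"
  proof (rule sum.cong [OF refl])
    fix w assume "w \<in> t"
    then obtain \<gamma> where "is_composition \<gamma>" "w = M \<gamma>" using t by auto
    thus "u w * coeff w ?m = (if w = v then u v else 0)"
      using \<beta> coeff_M_self[of \<beta>] coeff_M_other[of \<beta> \<gamma>] by (cases "\<gamma> = \<beta>") auto
  qed
  also have "\<dots> = u v" using t v by simp
  finally show "u v = 0" by simp
qed

fun partial_sums :: "nat \<Rightarrow> nat list \<Rightarrow> nat list" where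
  "partial_sums a [] = []"
| "partial_sums a (b # bs) = (a + b) # partial_sums (a + b) bs"

lemma partial_sums_gaps: "sorted (a # ys) \<Longrightarrow> partial_sums a (gaps a ys) = ys"
  by (induction ys arbitrary: a) auto

lemma gaps_partial_sums: "gaps a (partial_sums a bs) = bs"
  by (induction bs arbitrary: a) auto

lemma strict_sorted_partial_sums: "is_composition bs \<Longrightarrow> sorted_wrt (<) (a # partial_sums a bs)"
proof (induction bs arbitrary: a)
  case (Cons b bs)
  hence "sorted_wrt (<) ((a + b) # partial_sums (a + b) bs)" "0 < b"
    by (auto simp: is_composition_def)
  thus ?case by auto
qed simp

lemma is_composition_gaps: "sorted_wrt (<) (a # ys) \<Longrightarrow> is_composition (gaps a ys)"
  by (induction ys arbitrary: a) (auto simp: is_composition_def)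

lemma sorted_index_list:
  fixes S :: "nat set"
  assumes "S \<subseteq> {1..n}"
  shows "sorted_wrt (<) (0 # sorted_list_of_set S @ [n + 1])"
proof -
  have "finite S" using assms by (rule finite_subset) simp
  thus ?thesis using assms
    by (auto simp: sorted_wrt_append le_imp_less_Suc)
qed

lemma composition_of_is_composition: "S \<subseteq> {1..n} \<Longrightarrow> is_composition (composition_of n S)"
  unfolding composition_of_def using is_composition_gaps sorted_index_list by blast

lemma partial_sums_composition_of:
  assumes "S \<subseteq> {1..n}"
  shows "partial_sums 0 (composition_of n S) = sorted_list_of_set S @ [n + 1]"
  unfolding composition_of_def
  by (rule partial_sums_gaps) (metis sorted_index_list[OF assms] strict_sorted_iff)

lemma composition_of_inject:
  assumes "S \<subseteq> {1..n}" "T \<subseteq> {1..k}" "composition_of n S = composition_of k T"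
  shows "n = k" "S = T"
proof -
  have eq: "sorted_list_of_set S @ [n + 1] = sorted_list_of_set T @ [k + 1]"
    using assms partial_sums_composition_of by metis
  thus "n = k" by simp
  have "finite S" "finite T"
    using assms(1,2) by (auto intro: finite_subset[OF _ finite_atLeastAtMost])
  thus "S = T" using eq by (metis append1_eq_conv set_sorted_list_of_set)
qed

lemma composition_of_nonempty: "composition_of n S \<noteq> []"
  unfolding composition_of_def by (cases "sorted_list_of_set S") auto

lemma composition_of_surj:
  assumes "is_composition \<beta>" "\<beta> \<noteq> []"
  obtains n S where "S \<subseteq> {1..n}" "\<beta> = composition_of n S"
proof -
  define ys where "ys = partial_sums 0 \<beta>"
  have "ys \<noteq> []" using assms by (cases \<beta>) (auto simp: ys_def)
  then obtain xs y where ys: "ys = xs @ [y]" by (metis append_butlast_last_id)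
  have s: "sorted_wrt (<) (0 # xs @ [y])"
    using strict_sorted_partial_sums[OF assms(1), of 0] by (simp add: ys_def [symmetric] ys)
  hence y: "y = (y - 1) + 1" by simp
  have "sorted_list_of_set (set xs) = xs"
    using s by (simp add: sorted_wrt_append strict_sorted_iff
        sorted_list_of_set.idem_if_sorted_distinct)
  hence "\<beta> = composition_of (y - 1) (set xs)"
    using gaps_partial_sums[of 0 \<beta>] y by (simp add: composition_of_def ys_def [symmetric] ys)
  moreover have "set xs \<subseteq> {1..y - 1}"
  proof
    fix x assume "x \<in> set xs"
    hence "0 < x" "x < y" using s by (auto simp: sorted_wrt_append)
    thus "x \<in> {1..y - 1}" by simp
  qed
  ultimately show ?thesis using that by blast
qed

lemma linear_extension_MS:
  "\<exists>h. linear_map h \<and> h 1 = z \<and> (\<forall>n S. S \<subseteq> {1..n} \<longrightarrow> h (MS n S) = g n S)"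
proof -
  define P where "P = (\<lambda>b p. snd p \<subseteq> {1..fst p} \<and> b = MS (fst p) (snd p))"
  define f where "f = (\<lambda>b. if b = 1 then z else
    g (fst (SOME p. P b p)) (snd (SOME p. P b p)))"
  obtain h where h: "linear_map h" "\<forall>b\<in>M ` {\<beta>. is_composition \<beta>}. h b = f b"
    using qs_pair.linear_independent_extend[OF independent_M] by blast
  have "(1 :: series) \<in> M ` {\<beta>. is_composition \<beta>}"
    by (rule image_eqI[of _ _ "[]"]) (auto simp: M_Nil is_composition_def)
  hence "h 1 = z" using h(2) by (auto simp: f_def)
  moreover have "h (MS n S) = g n S" if S: "S \<subseteq> {1..n}" for n S
  proof -
    have *: "(k, T) = (n, S)" if "P (MS n S) (k, T)" for k T
    proof -
      from that have T: "T \<subseteq> {1..k}" "M (composition_of n S) = M (composition_of k T)"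
        by (auto simp: P_def MS_def)
      hence "composition_of n S = composition_of k T"
        using S composition_of_is_composition by (intro M_inject) auto
      thus ?thesis using composition_of_inject[OF S T(1)] by simp
    qed
    have "P (MS n S) (n, S)" using S by (simp add: P_def)
    hence "(SOME p. P (MS n S) p) = (n, S)"
      using * by (intro some_equality) (auto simp: split_paired_all)
    moreover have "MS n S \<noteq> 1"
    proof
      assume "MS n S = 1"
      hence "composition_of n S = []"
        using S composition_of_is_composition
        by (intro M_inject) (auto simp: MS_def M_Nil is_composition_def)
      thus False using composition_of_nonempty by blast
    qed
    moreover have "MS n S \<in> M ` {\<beta>. is_composition \<beta>}"
      using S composition_of_is_composition by (auto simp: MS_def)
    moreover from this have "h (MS n S) = f (MS n S)" using h(2) by blast
    ultimately show ?thesis by (simp add: f_def)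
  qed
  ultimately show ?thesis using h(1) by blast
qed

lemma FS_inversion:
  assumes "S \<subseteq> {1..n}"
  shows "MS n S = (\<Sum>T | S \<subseteq> T \<and> T \<subseteq> {1..n}. scale ((-1) ^ (card S + card T)) (FS n T))"
proof -
  let ?A = "\<lambda>S. {T. S \<subseteq> T \<and> T \<subseteq> {1..n}}"
  have fin': "finite (?A S)" for S by simp
  have finS: "finite U" if "U \<subseteq> {1..n}" for U using that by (rule finite_subset) simp
  have "(\<Sum>T\<in>?A S. scale ((-1) ^ (card S + card T)) (FS n T)) =
      (\<Sum>T\<in>?A S. \<Sum>U | U \<in> ?A S \<and> T \<subseteq> U. scale ((-1) ^ (card S + card T)) (MS n U))"
    unfolding FS_def qs.scale_sum_right by (intro sum.cong) auto
  also have "\<dots> = (\<Sum>U\<in>?A S. \<Sum>T | T \<in> ?A S \<and> T \<subseteq> U. scale ((-1) ^ (card S + card T)) (MS n U))"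
    by (rule sum.swap_restrict) (rule fin')+
  also have "\<dots> = (\<Sum>U\<in>?A S. if U = S then MS n S else 0)"
  proof (rule sum.cong [OF refl])
    fix U assume U: "U \<in> ?A S"
    have eq: "{T. T \<in> ?A S \<and> T \<subseteq> U} = {T. T \<subseteq> U \<and> S \<subseteq> T}" using U by auto
    have "(\<Sum>T | T \<in> ?A S \<and> T \<subseteq> U. scale ((-1) ^ (card S + card T)) (MS n U)) =
        scale ((-1) ^ card S * (\<Sum>T | T \<subseteq> U \<and> S \<subseteq> T. (-1) ^ card T)) (MS n U)"
      unfolding eq by (simp add: qs.scale_sum_left sum_distrib_left power_add)
    also have "\<dots> = (if U = S then MS n S else 0)"
    proof (cases "U = S")
      case True
      have "{T. T \<subseteq> S \<and> S \<subseteq> T} = {S}" by auto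
      thus ?thesis using True by (simp flip: power_add)
    next
      case False
      hence "S \<subset> U" using U by auto
      have "finite U" using U finS by auto
      have "(\<Sum>T\<in>{T. T \<subseteq> U \<and> S \<subseteq> T}. (-1) ^ card T) = (0 :: rat)"
        using card_subsupersets_even_odd[OF \<open>finite U\<close> \<open>S \<subset> U\<close>] \<open>finite U\<close>
        by (intro sum_alternating_cancels) (auto simp: conj_ac)
      thus ?thesis using False by simp
    qed
    finally show "(\<Sum>T | T \<in> ?A S \<and> T \<subseteq> U. scale ((-1) ^ (card S + card T)) (MS n U)) =
      (if U = S then MS n S else 0)" .
  qed
  also have "\<dots> = MS n S" using assms fin'[of S] by simp
  finally show ?thesis by simp
qed

lemma ex_is_\<theta>: "\<exists>h. is_\<theta> h"
proof -
  let ?A = "\<lambda>n S. {T. S \<subseteq> T \<and> T \<subseteq> {1..n}}"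
  have ex: "\<exists>g. \<forall>S. S \<subseteq> {1..n} \<longrightarrow> (\<Sum>T\<in>?A n S. g T) = \<Theta> n (\<Lambda> S)" for n
  proof -
    define r where "r = {(T, S). S \<subset> T \<and> T \<subseteq> {1..n :: nat}}"
    have "r \<subseteq> measure (\<lambda>S. n - card S)"
    proof clarify
      fix T S assume "(T, S) \<in> r"
      hence TS: "S \<subset> T" "T \<subseteq> {1..n}" by (auto simp: r_def)
      hence "finite T" using finite_subset[OF TS(2)] by simp
      hence "card S < card T" using TS(1) by (rule psubset_card_mono)
      moreover have "card T \<le> n" using card_mono[OF _ TS(2)] by simp
      ultimately show "(T, S) \<in> measure (\<lambda>S. n - card S)" by simp
    qed
    hence "wf r" by (rule wf_subset[OF wf_measure])
    define g where "g = wfrec r (\<lambda>g S. \<Theta> n (\<Lambda> S) - (\<Sum>T | S \<subset> T \<and> T \<subseteq> {1..n}. g T))"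
    have g: "g S = \<Theta> n (\<Lambda> S) - (\<Sum>T | S \<subset> T \<and> T \<subseteq> {1..n}. g T)" for S
    proof -
      have "g S = \<Theta> n (\<Lambda> S) - (\<Sum>T | S \<subset> T \<and> T \<subseteq> {1..n}. cut g r S T)"
        unfolding g_def by (subst wfrec[OF \<open>wf r\<close>]) simp
      also have "(\<Sum>T | S \<subset> T \<and> T \<subseteq> {1..n}. cut g r S T) = (\<Sum>T | S \<subset> T \<and> T \<subseteq> {1..n}. g T)"
        by (intro sum.cong) (auto simp: cut_def r_def)
      finally show ?thesis .
    qed
    have "(\<Sum>T\<in>?A n S. g T) = \<Theta> n (\<Lambda> S)" if "S \<subseteq> {1..n}" for S
    proof -
      have "?A n S = insert S {T. S \<subset> T \<and> T \<subseteq> {1..n}}" using that by auto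
      moreover have "finite {T. S \<subset> T \<and> T \<subseteq> {1..n}}" by simp
      ultimately show ?thesis using g[of S] by simp
    qed
    thus ?thesis by blast
  qed
  then obtain g where g: "\<And>n S. S \<subseteq> {1..n} \<Longrightarrow> (\<Sum>T\<in>?A n S. g n T) = \<Theta> n (\<Lambda> S)"
    by metis
  obtain h where h: "linear_map h" "h 1 = 1" "\<And>n S. S \<subseteq> {1..n} \<Longrightarrow> h (MS n S) = g n S"
    using linear_extension_MS[of 1 g] by blast
  have "h (FS n S) = \<Theta> n (\<Lambda> S)" if "S \<subseteq> {1..n}" for n S
  proof -
    have "h (FS n S) = (\<Sum>T\<in>?A n S. h (MS n T))"
      unfolding FS_def using h(1) by (simp add: qs_pair.linear_sum)
    also have "\<dots> = (\<Sum>T\<in>?A n S. g n T)" using h(3) by (intro sum.cong) auto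
    finally show ?thesis using g[OF that] by simp
  qed
  thus ?thesis using h unfolding is_\<theta>_def by blast
qed

lemma is_\<theta>_\<theta>: "is_\<theta> \<theta>"
  unfolding \<theta>_def using ex_is_\<theta> by (rule someI_ex)

lemma \<theta>_unique:
  assumes "is_\<theta> h" "f \<in> QSym"
  shows "h f = \<theta> f"
proof (rule qs_pair.linear_eq_on[of h \<theta> f "M ` {\<beta>. is_composition \<beta>}"])
  show lin: "linear_map h" "linear_map \<theta>"
    using assms(1) is_\<theta>_\<theta> by (auto simp: is_\<theta>_def)
  show "f \<in> qs.span (M ` {\<beta>. is_composition \<beta>})"
    using assms(2) by (simp add: QSym_def)
  fix b assume "b \<in> M ` {\<beta>. is_composition \<beta>}"
  then obtain \<beta> where \<beta>: "is_composition \<beta>" "b = M \<beta>" by auto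
  show "h b = \<theta> b"
  proof (cases "\<beta> = []")
    case True
    thus ?thesis using \<beta> assms(1) is_\<theta>_\<theta> by (simp add: M_Nil is_\<theta>_def)
  next
    case False
    then obtain n S where S: "S \<subseteq> {1..n}" "b = MS n S"
      using composition_of_surj[OF \<beta>(1)] \<beta>(2) unfolding MS_def by metis
    show ?thesis
      unfolding S(2) FS_inversion[OF S(1)] qs_pair.linear_sum[OF lin(1)]
        qs_pair.linear_sum[OF lin(2)] qs_pair.linear_scale[OF lin(1)]
        qs_pair.linear_scale[OF lin(2)]
      using assms(1) is_\<theta>_\<theta> by (intro sum.cong) (auto simp: is_\<theta>_def)
  qed
qed

lemma is_L_L: "is_L L"
proof -
  obtain h where "linear_map h" "\<And>n S. S \<subseteq> {1..n} \<Longrightarrow> h (MS n S) = MS (n + 1) S"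
    using linear_extension_MS[of 0 "\<lambda>n. MS (n + 1)"] by auto
  hence "is_L h" by (simp add: is_L_def)
  thus ?thesis unfolding L_def by (rule someI[of is_L])
qed

lemma L_unique:
  assumes "is_L h" "f \<in> qs.span (M ` {\<beta>. is_composition \<beta> \<and> \<beta> \<noteq> []})"
  shows "h f = L f"
proof (rule qs_pair.linear_eq_on[OF _ _ assms(2)])
  show "linear_map h" "linear_map L"
    using assms(1) is_L_L by (auto simp: is_L_def)
  fix b assume "b \<in> M ` {\<beta>. is_composition \<beta> \<and> \<beta> \<noteq> []}"
  then obtain \<beta> where \<beta>: "is_composition \<beta>" "\<beta> \<noteq> []" "b = M \<beta>" by blast
  obtain n S where "S \<subseteq> {1..n}" "b = MS n S"
    using composition_of_surj[OF \<beta>(1,2)] \<beta>(3) unfolding MS_def by metis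
  thus "h b = L b"
    using assms(1) is_L_L by (simp add: is_L_def)
qed


section \<open>Words in c and d\<close>

datatype letter = LC | LD

fun letter_degree :: "letter \<Rightarrow> nat" where
  "letter_degree LC = 1"
| "letter_degree LD = 2"

definition word_degree :: "letter list \<Rightarrow> nat"
  where "word_degree w = sum_list (map letter_degree w)"

fun letter_op :: "letter \<Rightarrow> series \<Rightarrow> series" where
  "letter_op LC = (\<lambda>f. \<Theta>\<^sub>1 * f)"
| "letter_op LD = L \<circ> L"

fun word_op :: "letter list \<Rightarrow> series \<Rightarrow> series" where
  "word_op [] = id"
| "word_op (x # w) = letter_op x \<circ> word_op w"

definition \<Omega> :: "letter list \<Rightarrow> series"
  where "\<Omega> w = word_op w \<Theta>\<^sub>1"


section \<open>Eigenvectors and diagonalizability\<close>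

definition eigenvector :: "(series \<Rightarrow> series) \<Rightarrow> rat \<Rightarrow> series \<Rightarrow> bool"
  where "eigenvector h c f \<longleftrightarrow> f \<noteq> 0 \<and> h f = scale c f"

definition diagonalizable_on :: "(series \<Rightarrow> series) \<Rightarrow> series set \<Rightarrow> bool"
  where "diagonalizable_on h V \<longleftrightarrow> h ` V \<subseteq> V \<and>
    (\<exists>B. qs.independent B \<and> qs.span B = V \<and> (\<forall>b\<in>B. \<exists>c. eigenvector h c b))"

end

theory Submission
  imports Defs
begin

text \<open>
  A quasisymmetric function is determined by its coefficients at compositions, so the coefficient
  functions of quasisymmetric functions are functionals on the free algebra on $y_1, y_2, \dots$,
  where the word $y_{\beta_1} \cdots y_{\beta_k}$ reads off the coefficient of $M_\beta$. Write
  $y(t) = 1 + \sum_{i \ge 1} y_i t^i$. Three operators on quasisymmetric functions become simple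
  operations on words:

   \<^item> $\vartheta$ is dual to the algebra homomorphism $y(t) \mapsto z(t) = y(-t)^{-1} y(t)$
     (\<open>theta_block\<close>, \<open>theta_coeff\<close>, \<open>wcoeff_\<theta>\<close>). This is checked on the fundamental basis;
   \<^item> multiplication by $M_{(1)}$ is dual to the derivation with $y(t) \mapsto t\, y(t)$
     (\<open>lower_one\<close>);
   \<^item> $L^2$ is dual to lowering the last letter from $y_k$ to $y_{k-2}$ (\<open>lower_last_two\<close>).

  Differentiating $z(t) = y(-t)^{-1} y(t)$ gives $2 t\, z(t)$, whence $\vartheta(\Theta_{\bf 1} F)
  = 2 \Theta_{\bf 1} \vartheta(F)$. The words that occur in $z_k$ end in odd letters, and lowering
  these by 2 turns $z_k$ into $z_{k-2}$, so $\vartheta$ commutes with $L^2$. As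
  $\vartheta(\Theta_{\bf 1}) = 2 \Theta_{\bf 1}$, every $\Omega_w$ is an eigenvector with
  eigenvalue $2^{|w|_{\bf c} + 1}$. Since the eigenvalue is not 0, $\Omega_w$ lies in the image of
  $\vartheta$, and so in $\Pi$.

  The $\Omega_w$ and 1 are linearly independent because $\Theta_{\bf 1} F + L^2 G = 0$ forces $F =
  G = 0$ (\<open>\<Theta>\<^sub>1_L_L_independent\<close>): coefficients at compositions ending in 1 do not see $L^2 G$, and
  they determine $F$ by a triangular system.

  They span $\Pi$ by a dimension bound. The identity $z(-t) z(t) = 1$ says that the functions in
  the image of $\vartheta$ satisfy linear relations, here called the Euler relations: substituting
  $-t$ and $t$ for two consecutive variables removes them. These relations are visibly preserved
  by products, so all of $\Pi$ satisfies them (\<open>Peak_subset_Euler\<close>). They express every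
  coefficient through those at compositions into odd parts, and the compositions of $n + 1$ into
  odd parts correspond to the words of degree $n$ (\<open>odd_composition_surj\<close>). Hence there is no room
  in degree $n + 1$ for anything but the span of the $\Omega_w$ (\<open>Euler_graded_spanned\<close>).
\<close>

section \<open>The operation dual to $\vartheta$\<close>

text \<open>
  Multiplication by $y_i$ from the left, seen on functionals: $y_0$ is the unit, so index 0
  prepends nothing.
\<close>

definition front :: "nat \<Rightarrow> (nat list \<Rightarrow> rat) \<Rightarrow> nat list \<Rightarrow> rat"
  where "front i f \<delta> = f (if i = 0 then \<delta> else i # \<delta>)"

text \<open>
  The action of the coefficient $z_m$ of $z(t) = y(-t)^{-1} y(t)$. The recursion is $y(-t) z(t) =
  y(t)$ solved for $z_m$.
\<close>

fun theta_block :: "nat \<Rightarrow> (nat list \<Rightarrow> rat) \<Rightarrow> nat list \<Rightarrow> rat" where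
  "theta_block m f = (if m = 0 then f else (\<lambda>\<delta>. (1 - (-1) ^ m) * f (m # \<delta>) -
     (\<Sum>i\<in>{1..<m}. (-1) ^ i * theta_block (m - i) (\<lambda>\<epsilon>. f (i # \<epsilon>)) \<delta>)))"

declare theta_block.simps [simp del]

text \<open>
  The value of the functional \<open>f\<close> at the word $z_{\gamma_1} z_{\gamma_2} \cdots$.
\<close>

fun theta_coeff :: "(nat list \<Rightarrow> rat) \<Rightarrow> nat list \<Rightarrow> rat" where
  "theta_coeff f [] = f []"
| "theta_coeff f (m # \<gamma>) = theta_coeff (theta_block m f) \<gamma>"

lemma front_0 [simp]: "front 0 f = f"
  by (simp add: front_def fun_eq_iff)

lemma front_pos: "0 < i \<Longrightarrow> front i f \<delta> = f (i # \<delta>)"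
  by (simp add: front_def)

lemma front_pos': "0 < i \<Longrightarrow> front i f = (\<lambda>\<delta>. f (i # \<delta>))"
  by (simp add: front_def fun_eq_iff)

lemma theta_block_0 [simp]: "theta_block 0 f = f"
  by (simp add: theta_block.simps)

lemma theta_block_pos: "0 < m \<Longrightarrow> theta_block m f \<delta> = (1 - (-1) ^ m) * front m f \<delta> -
     (\<Sum>i\<in>{1..<m}. (-1) ^ i * theta_block (m - i) (front i f) \<delta>)"
  by (subst theta_block.simps) (simp add: front_pos')

text \<open>
  The coefficient of $t^m$ in $y(-t)\, z(t) = y(t)$.
\<close>

lemma theta_block_sum:
  "(\<Sum>i\<le>m. (-1) ^ i * theta_block (m - i) (front i f) \<delta>) = front m f \<delta>"
proof (cases "m = 0")
  case False
  hence "{..m} = insert 0 (insert m {1..<m})" by auto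
  thus ?thesis using False theta_block_pos[of m f \<delta>] by (simp add: algebra_simps)
qed simp

lemma theta_block_linear:
  "theta_block m (\<lambda>\<delta>. a * f \<delta> + g \<delta>) \<delta> = a * theta_block m f \<delta> + theta_block m g \<delta>"
proof (induction m arbitrary: f g \<delta> rule: less_induct)
  case (less m)
  show ?case
  proof (cases "m = 0")
    case False
    have "(\<Sum>i\<in>{1..<m}. (-1) ^ i * theta_block (m - i) (front i (\<lambda>\<delta>. a * f \<delta> + g \<delta>)) \<delta>) =
      (\<Sum>i\<in>{1..<m}. (-1) ^ i * (a * theta_block (m - i) (front i f) \<delta> + theta_block (m - i) (front
          i g) \<delta>))"
      by (intro sum.cong) (auto simp: front_pos' less)
    also have "\<dots> = a * (\<Sum>i\<in>{1..<m}. (-1) ^ i * theta_block (m - i) (front i f) \<delta>) +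
       (\<Sum>i\<in>{1..<m}. (-1) ^ i * theta_block (m - i) (front i g) \<delta>)"
      by (simp add: algebra_simps sum.distrib sum_distrib_left)
    finally show ?thesis using False
      by (simp add: theta_block_pos front_pos' algebra_simps)
  qed simp
qed

lemma theta_block_zero: "theta_block m (\<lambda>_. 0) \<delta> = 0"
  using theta_block_linear[of m "-1" "\<lambda>_. 0" "\<lambda>_. 0" \<delta>] by simp

lemma theta_block_scale: "theta_block m (\<lambda>\<delta>. a * f \<delta>) \<delta> = a * theta_block m f \<delta>"
  using theta_block_linear[of m a f "\<lambda>_. 0"] by (simp add: theta_block_zero)

lemma theta_block_add:
  "theta_block m (\<lambda>\<delta>. f \<delta> + g \<delta>) \<delta> = theta_block m f \<delta> + theta_block m g \<delta>"
  using theta_block_linear[of m 1 f g] by simp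

lemma theta_block_lincomb:
  "finite I \<Longrightarrow> theta_block m (\<lambda>\<delta>. \<Sum>i\<in>I. a i * f i \<delta>) \<delta> = (\<Sum>i\<in>I. a i * theta_block m (f i) \<delta>)"
proof (induction I rule: finite_induct)
  case empty
  show ?case by (simp add: theta_block_zero)
next
  case (insert x F)
  thus ?case using theta_block_linear[of m "a x" "f x" "\<lambda>\<delta>. \<Sum>i\<in>F. a i * f i \<delta>"]
    by simp
qed

lemma theta_block_cong:
  assumes "\<And>\<delta>. is_composition \<delta> \<Longrightarrow> f \<delta> = g \<delta>" "is_composition \<delta>"
  shows "theta_block m f \<delta> = theta_block m g \<delta>"
  using assms
proof (induction m arbitrary: f g \<delta> rule: less_induct)
  case (less m)
  show ?case
  proof (cases "m = 0")
    case False
    have "theta_block (m - i) (front i f) \<delta> = theta_block (m - i) (front i g) \<delta>" if "i \<in> {1..<m}"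
        for i
      using that less.prems by (intro less.IH) (auto simp: front_pos is_composition_def)
    moreover have "front m f \<delta> = front m g \<delta>"
      using False less.prems by (auto simp: front_pos is_composition_def)
    ultimately show ?thesis using False by (simp add: theta_block_pos)
  qed (use less.prems in simp)
qed

lemma theta_coeff_cong:
  assumes "\<And>\<delta>. is_composition \<delta> \<Longrightarrow> f \<delta> = g \<delta>"
  shows "theta_coeff f \<gamma> = theta_coeff g \<gamma>"
  using assms
proof (induction \<gamma> arbitrary: f g)
  case Nil
  thus ?case by (simp add: is_composition_def)
next
  case (Cons m \<gamma>)
  show ?case unfolding theta_coeff.simps
    by (rule Cons.IH) (rule theta_block_cong[OF Cons.prems])
qed

lemma theta_coeff_linear:
  "theta_coeff (\<lambda>\<delta>. a * f \<delta> + g \<delta>) \<gamma> = a * theta_coeff f \<gamma> + theta_coeff g \<gamma>"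
  by (induction \<gamma> arbitrary: f g) (simp_all add: theta_block_linear[abs_def])

lemma theta_coeff_zero: "theta_coeff (\<lambda>_. 0) \<gamma> = 0"
  using theta_coeff_linear[of "-1" "\<lambda>_. 0" "\<lambda>_. 0"] by simp

lemma theta_coeff_scale: "theta_coeff (\<lambda>\<delta>. a * f \<delta>) \<gamma> = a * theta_coeff f \<gamma>"
  using theta_coeff_linear[of a f "\<lambda>_. 0"] by (simp add: theta_coeff_zero)

lemma theta_coeff_append: "\<exists>g. \<forall>\<gamma>. theta_coeff f (\<alpha> @ \<gamma>) = theta_coeff g \<gamma>"
  by (induction \<alpha> arbitrary: f) auto

text \<open>
  $z_0$ is the unit.
\<close>

lemma theta_coeff_weak: "theta_coeff f (filter (\<lambda>i. i \<noteq> 0) \<gamma>) = theta_coeff f \<gamma>"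
  by (induction \<gamma> arbitrary: f) auto

section \<open>The Euler relations\<close>

text \<open>
  Each sum is the coefficient of $t^k$ times a monomial in the other variables after two
  consecutive variables are replaced by $-t$ and $t$; the relations say that the result does not
  depend on $t$. In the free algebra they generate the ideal of $y(-t) y(t) = 1$.
\<close>

definition euler :: "(nat list \<Rightarrow> rat) \<Rightarrow> bool"
  where "euler f \<longleftrightarrow> (\<forall>\<alpha> \<gamma> k. 0 < k \<longrightarrow> (\<Sum>j\<le>k. (-1) ^ j * f (\<alpha> @ j # (k - j) # \<gamma>)) = 0)"

lemma triangle_sum:
  fixes g :: "nat \<Rightarrow> nat \<Rightarrow> 'a :: comm_monoid_add"
  shows "(\<Sum>i\<le>m. \<Sum>j\<le>m - i. g i j) = (\<Sum>n\<le>m. \<Sum>i\<le>n. g i (n - i))"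
proof -
  have "(\<Sum>i\<le>m. \<Sum>j\<le>m - i. g i j) = (\<Sum>(i, j)\<in>(SIGMA i:{..m}. {..m - i}). g i j)"
    by (simp add: sum.Sigma)
  also have "(SIGMA i:{..m}. {..m - i}) = {(i, j). i + j \<le> m}" by auto
  finally show ?thesis by (simp add: sum.triangle_reindex_eq)
qed

text \<open>
  This is $z(-t) z(t) = 1$. Instead of inverting $y(t)$, the proof multiplies by it from the left:
  $y(t) z(-t) z(t) = y(-t) z(t) = y(t)$. On the left the coefficients of $z(-t) z(t)$ in degrees
  strictly between 0 and \<open>m\<close> vanish by induction; comparing the coefficients of $t^m$ leaves the
  claim.
\<close>

lemma theta_block_inverse:
  "0 < m \<Longrightarrow> (\<Sum>j\<le>m. (-1) ^ j * theta_block (m - j) (theta_block j f) \<delta>) = 0"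
proof (induction m arbitrary: f rule: less_induct)
  case (less m)
  define A where "A = (\<lambda>m f. \<Sum>j\<le>m. (-1) ^ j * theta_block (m - j) (theta_block j f) \<delta>)"
  \<comment> \<open>\<open>A m f\<close> is the action of the coefficient of $t^m$ in $z(-t) z(t)$.\<close>
  have "(\<Sum>i\<le>m. A (m - i) (front i f)) =
      (\<Sum>i\<le>m. \<Sum>j\<le>m - i. (-1) ^ j * theta_block (m - i - j) (theta_block j (front i f)) \<delta>)"
    by (simp add: A_def)
  also have "\<dots> = (\<Sum>n\<le>m. \<Sum>i\<le>n. (-1) ^ (n - i) * theta_block (m - n) (theta_block (n - i) (front i
      f)) \<delta>)"
    unfolding triangle_sum by (intro sum.cong) auto
  also have "\<dots> = (\<Sum>n\<le>m. (-1) ^ n * theta_block (m - n) (front n f) \<delta>)"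
  proof (intro sum.cong refl)
    fix n
    have "(\<Sum>i\<le>n. (-1) ^ (n - i) * theta_block (m - n) (theta_block (n - i) (front i f)) \<delta>) =
        (-1) ^ n * theta_block (m - n) (\<lambda>\<delta>. \<Sum>i\<le>n. (-1) ^ i * theta_block (n - i) (front i f) \<delta>) \<delta>"
      unfolding theta_block_lincomb[OF finite_atMost] sum_distrib_left
      by (intro sum.cong refl) (auto simp: minus_one_power_iff)
    thus "(\<Sum>i\<le>n. (-1) ^ (n - i) * theta_block (m - n) (theta_block (n - i) (front i f)) \<delta>) =
        (-1) ^ n * theta_block (m - n) (front n f) \<delta>"
      by (simp add: theta_block_sum[abs_def])
  qed
  also have "\<dots> = front m f \<delta>" by (rule theta_block_sum)
  also have "(\<Sum>i\<le>m. A (m - i) (front i f)) = (\<Sum>i\<in>{0, m}. A (m - i) (front i f))"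
  proof (rule sum.mono_neutral_right)
    have "A (m - i) (front i f) = 0" if "0 < i" "i < m" for i
      unfolding A_def using that by (intro less.IH) auto
    thus "\<forall>i\<in>{..m} - {0, m}. A (m - i) (front i f) = 0" by auto
  qed auto
  finally show ?case using less.prems by (simp add: A_def)
qed

lemma euler_theta_coeff: "euler (theta_coeff f)"
  unfolding euler_def
proof (intro allI impI)
  fix \<alpha> \<gamma> :: "nat list" and k :: nat assume k: "0 < k"
  obtain g where g: "\<And>\<gamma>. theta_coeff f (\<alpha> @ \<gamma>) = theta_coeff g \<gamma>"
    using theta_coeff_append by blast
  have sum: "theta_coeff (\<lambda>\<delta>. \<Sum>i\<in>I. a i * h i \<delta>) \<gamma> = (\<Sum>i\<in>I. a i * theta_coeff (h i) \<gamma>)"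
    if "finite I" for I :: "nat set" and a h
    using that
  proof (induction I rule: finite_induct)
    case (insert x F)
    thus ?case using theta_coeff_linear[of "a x" "h x" "\<lambda>\<delta>. \<Sum>i\<in>F. a i * h i \<delta>"] by simp
  qed (simp add: theta_coeff_zero)
  show "(\<Sum>j\<le>k. (-1) ^ j * theta_coeff f (\<alpha> @ j # (k - j) # \<gamma>)) = 0"
    using sum[of "{..k}" "\<lambda>j. (-1) ^ j" "\<lambda>j. theta_block (k - j) (theta_block j g)"]
      theta_block_inverse[OF k] by (simp add: g theta_coeff_zero)
qed

section \<open>The operation dual to multiplication by $M_{(1)}$\<close>

text \<open>
  The derivation $y_b \mapsto y_{b-1}$, with $y_0 = 1$.
\<close>

fun lower_one :: "(nat list \<Rightarrow> rat) \<Rightarrow> nat list \<Rightarrow> rat" where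
  "lower_one f [] = 0"
| "lower_one f (b # \<beta>) = front (b - 1) f \<beta> + lower_one (\<lambda>\<delta>. f (b # \<delta>)) \<beta>"

lemma lower_one_linear:
  "lower_one (\<lambda>\<delta>. a * f \<delta> + g \<delta>) \<beta> = a * lower_one f \<beta> + lower_one g \<beta>"
  by (induction \<beta> arbitrary: f g) (simp_all add: front_def algebra_simps)

lemma lower_one_zero: "lower_one (\<lambda>_. 0) \<beta> = 0"
  using lower_one_linear[of "-1" "\<lambda>_. 0" "\<lambda>_. 0"] by simp

lemma lower_one_lincomb:
  "finite I \<Longrightarrow> lower_one (\<lambda>\<delta>. \<Sum>i\<in>I. a i * f i \<delta>) \<delta> = (\<Sum>i\<in>I. a i * lower_one (f i) \<delta>)"
proof (induction I rule: finite_induct)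
  case (insert x F)
  thus ?case using lower_one_linear[of "a x" "f x" "\<lambda>\<delta>. \<Sum>i\<in>F. a i * f i \<delta>"] by simp
qed (simp add: lower_one_zero)

lemma front_lower_one:
  "0 < i \<Longrightarrow> front i (lower_one f) = (\<lambda>\<delta>. front (i - 1) f \<delta> + lower_one (front i f) \<delta>)"
  by (simp add: front_pos' fun_eq_iff)

text \<open>
  The derivation $D$ with $D\, y(t) = t\, y(t)$ sends $y(-t)^{-1}$ to $t\, y(-t)^{-1}$, hence $D\,
  z(t) = 2 t\, z(t)$. The proof reads this off the recursion for $z_m$: the two alternating sums
  \<open>s1\<close>, \<open>s2\<close> that appear are themselves values of \<open>theta_block_sum\<close> in degree \<open>m - 1\<close>.
\<close>

lemma theta_block_lower_one:
  "0 < m \<Longrightarrow> theta_block m (lower_one f) \<delta> = 2 * theta_block (m - 1) f \<delta> + lower_one (theta_block m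
      f) \<delta>"
proof (induction m arbitrary: f rule: less_induct)
  case (less m)
  define c :: rat where "c = 1 - (-1) ^ m"
  have e: "{..m - 1} = insert 0 {1..<m}" using less.prems by auto
  have tb: "theta_block m f = (\<lambda>\<delta>. c * front m f \<delta> + (\<Sum>i\<in>{1..<m}. - ((-1) ^ i) * theta_block (m -
      i) (front i f) \<delta>))"
    by (rule ext) (simp add: theta_block_pos[OF less.prems] c_def sum_negf)
  have low: "lower_one (theta_block m f) \<delta> = c * lower_one (front m f) \<delta> -
     (\<Sum>i\<in>{1..<m}. (-1) ^ i * lower_one (theta_block (m - i) (front i f)) \<delta>)"
    by (subst tb) (simp only: lower_one_linear lower_one_lincomb finite_atLeastLessThan,
        simp add: sum_negf)
  have s1: "(\<Sum>i\<in>{1..<m}. (-1) ^ i * theta_block (m - 1 - i) (front i f) \<delta>) = front (m - 1) f \<delta> -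
      theta_block (m - 1) f \<delta>"
    using theta_block_sum[of "m - 1" f \<delta>] unfolding e by simp
  have "(\<Sum>i\<in>{1..<m}. (-1) ^ i * theta_block (m - i) (front (i - 1) f) \<delta>) =
    - (\<Sum>i\<in>{..<m - 1}. (-1) ^ i * theta_block (m - 1 - i) (front i f) \<delta>)"
    unfolding sum_negf[symmetric]
    by (rule sum.reindex_bij_witness[of _ Suc "\<lambda>i. i - 1"]) (auto simp: minus_one_power_iff)
  also have "\<dots> = - (front (m - 1) f \<delta> - (-1) ^ (m - 1) * front (m - 1) f \<delta>)"
    using theta_block_sum[of "m - 1" f \<delta>] by (cases m) (auto simp: lessThan_Suc_atMost[symmetric]
        simp del: lessThan_Suc_atMost)
  finally have s2: "(\<Sum>i\<in>{1..<m}. (-1) ^ i * theta_block (m - i) (front (i - 1) f) \<delta>) = - c * front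
      (m - 1) f \<delta> - 2 * (-1) ^ m * front (m - 1) f \<delta>"
    using less.prems by (cases m) (auto simp: c_def algebra_simps)
  have "theta_block m (lower_one f) \<delta> = c * (front (m - 1) f \<delta> + lower_one (front m f) \<delta>) -
     (\<Sum>i\<in>{1..<m}. (-1) ^ i * (theta_block (m - i) (front (i - 1) f) \<delta> + (2 * theta_block (m - 1 -
         i) (front i f) \<delta> + lower_one (theta_block (m - i) (front i f)) \<delta>)))"
    unfolding theta_block_pos[OF less.prems] c_def
    using less.prems by (simp add: front_lower_one theta_block_add less.IH diff_right_commute)
  thus ?case
    unfolding low using s1 s2
    by (simp add: sum.distrib distrib_left sum_distrib_left[symmetric] mult.left_commute c_def)
        (simp add: algebra_simps)
qed

lemma theta_coeff_lower_one:
  "is_composition \<gamma> \<Longrightarrow> theta_coeff (lower_one f) \<gamma> = 2 * lower_one (theta_coeff f) \<gamma>"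
proof (induction \<gamma> arbitrary: f)
  case (Cons m \<gamma>)
  hence m: "0 < m" "is_composition \<gamma>" by (auto simp: is_composition_def)
  have "theta_coeff (lower_one f) (m # \<gamma>) = 2 * theta_coeff (theta_block (m - 1) f) \<gamma> +
      theta_coeff (lower_one (theta_block m f)) \<gamma>"
    unfolding theta_coeff.simps theta_coeff_linear[symmetric]
    by (rule arg_cong[of _ _ "\<lambda>f. theta_coeff f \<gamma>"]) (rule ext, rule theta_block_lower_one[OF m(1)])
  also have "theta_coeff (theta_block (m - 1) f) \<gamma> = front (m - 1) (theta_coeff f) \<gamma>"
    by (simp add: front_def)
  finally show ?case using Cons.IH[OF m(2)] by simp
qed simp

section \<open>The operation dual to $L^2$\<close>

text \<open>
  The operation replaces the last letter $y_k$ by $y_{k-2}$ and kills words with $k \le 2$. The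
  bound is $k \ge 3$, as $L^2$ maps no monomial quasisymmetric function to one with last part 2 or
  less.
\<close>

definition lower_last_two :: "(nat list \<Rightarrow> rat) \<Rightarrow> nat list \<Rightarrow> rat"
  where "lower_last_two f \<beta> = (if \<beta> \<noteq> [] \<and> 3 \<le> last \<beta> then f (butlast \<beta> @ [last \<beta> - 2]) else 0)"

lemma lower_last_two_Cons: "\<delta> \<noteq> [] \<Longrightarrow> lower_last_two f (b # \<delta>) = lower_last_two (\<lambda>\<delta>. f (b # \<delta>)) \<delta>"
  by (simp add: lower_last_two_def)

lemma lower_last_two_linear:
  "lower_last_two (\<lambda>\<delta>. a * f \<delta> + g \<delta>) \<beta> = a * lower_last_two f \<beta> + lower_last_two g \<beta>"
  by (simp add: lower_last_two_def)

lemma lower_last_two_lincomb: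
  "lower_last_two (\<lambda>\<delta>. \<Sum>i\<in>I. a i * f i \<delta>) \<delta> = (\<Sum>i\<in>I. a i * lower_last_two (f i) \<delta>)"
  by (simp add: lower_last_two_def)

lemma theta_block_cong_nonempty:
  assumes "\<And>\<delta>. \<delta> \<noteq> [] \<Longrightarrow> f \<delta> = g \<delta>" "0 < m \<or> \<delta> \<noteq> []"
  shows "theta_block m f \<delta> = theta_block m g \<delta>"
proof (cases "m = 0")
  case False
  have "front i f = front i g" if "0 < i" for i
    using that assms(1) by (simp add: front_pos')
  thus ?thesis using False by (simp add: theta_block_pos)
qed (use assms in simp)

lemma theta_coeff_cong_nonempty:
  assumes "\<And>\<delta>. \<delta> \<noteq> [] \<Longrightarrow> f \<delta> = g \<delta>" "\<gamma> \<noteq> []" "is_composition \<gamma>"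
  shows "theta_coeff f \<gamma> = theta_coeff g \<gamma>"
proof -
  obtain m \<delta> where \<gamma>: "\<gamma> = m # \<delta>" "0 < m" using assms by (cases \<gamma>) (auto simp: is_composition_def)
  have "theta_block m f = theta_block m g"
    using \<gamma>(2) assms(1) by (intro ext theta_block_cong_nonempty) auto
  thus ?thesis by (simp add: \<gamma>)
qed

text \<open>
  Two cases according to whether the last letter lies after the block or inside it. In the second
  case the statement is that lowering the last letter turns $z_m$ into $z_{m-2}$, and $z_1$, $z_2$
  into 0: each word in $z_m$ ends in an odd letter, and 1 is the only odd letter below 3.
\<close>

lemma theta_block_lower_last_two:
  "theta_block m (lower_last_two f) \<delta> = (if \<delta> \<noteq> [] then lower_last_two (theta_block m f) \<delta>
     else if 3 \<le> m then theta_block (m - 2) f [] else 0)"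
proof (induction m arbitrary: f \<delta> rule: less_induct)
  case (less m)
  show ?case
  proof (cases "m = 0")
    case True
    thus ?thesis by (simp add: lower_last_two_def)
  next
    case False
    define c :: rat where "c = 1 - (-1) ^ m"
    have fr: "theta_block (m - i) (front i (lower_last_two f)) \<delta> = theta_block (m - i)
        (lower_last_two (front i f)) \<delta>"
      if "i \<in> {1..<m}" for i
      using that by (intro theta_block_cong_nonempty) (auto simp: front_pos' lower_last_two_Cons)
    have eq: "theta_block m (lower_last_two f) \<delta> = c * lower_last_two f (m # \<delta>) -
       (\<Sum>i\<in>{1..<m}. (-1) ^ i * theta_block (m - i) (lower_last_two (front i f)) \<delta>)"
      using False fr by (simp add: theta_block_pos front_pos c_def)
    show ?thesis
    proof (cases "\<delta> = []")
      case True
      have "(\<Sum>i\<in>{1..<m}. (-1) ^ i * theta_block (m - i) (lower_last_two (front i f)) \<delta>) =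
         (\<Sum>i\<in>{1..<m}. if i < m - 2 then (-1) ^ i * theta_block (m - 2 - i) (front i f) [] else 0)"
        using True by (intro sum.cong refl) (auto simp: less.IH diff_right_commute)
      also have "\<dots> = (\<Sum>i\<in>{1..<m - 2}. (-1) ^ i * theta_block (m - 2 - i) (front i f) [])"
        by (intro sum.mono_neutral_cong_right) auto
      finally have *: "(\<Sum>i\<in>{1..<m}. (-1) ^ i * theta_block (m - i) (lower_last_two (front i f)) \<delta>) =
        (\<Sum>i\<in>{1..<m - 2}. (-1) ^ i * theta_block (m - 2 - i) (front i f) [])" .
      show ?thesis
      proof (cases "3 \<le> m")
        case m3: True
        hence "c = 1 - (-1) ^ (m - 2)" by (simp add: c_def minus_one_power_iff)
        thus ?thesis using m3 True
          unfolding eq * by (simp add: theta_block_pos[of "m - 2"] lower_last_two_def front_pos)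
      next
        case False
        thus ?thesis using True unfolding eq * by (simp add: lower_last_two_def)
      qed
    next
      case nonempty: False
      define t where "t = (\<lambda>\<delta>. c * front m f \<delta> + (\<Sum>i\<in>{1..<m}. - ((-1) ^ i) * theta_block (m - i)
          (front i f) \<delta>))"
      have tb: "theta_block m f = t"
        unfolding t_def using False by (intro ext) (simp add: theta_block_pos c_def sum_negf)
      have "lower_last_two (theta_block m f) \<delta> = c * lower_last_two (front m f) \<delta> -
        (\<Sum>i\<in>{1..<m}. (-1) ^ i * lower_last_two (theta_block (m - i) (front i f)) \<delta>)"
        unfolding tb t_def by (simp only: lower_last_two_linear lower_last_two_lincomb) (simp add:
            sum_negf)
      moreover have "(\<Sum>i\<in>{1..<m}. (-1) ^ i * theta_block (m - i) (lower_last_two (front i f)) \<delta>) =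
         (\<Sum>i\<in>{1..<m}. (-1) ^ i * lower_last_two (theta_block (m - i) (front i f)) \<delta>)"
        using nonempty by (intro sum.cong refl) (simp add: less.IH)
      ultimately show ?thesis using nonempty False
        by (simp add: eq lower_last_two_Cons front_pos')
    qed
  qed
qed

lemma theta_coeff_lower_last_two:
  "is_composition \<gamma> \<Longrightarrow> theta_coeff (lower_last_two f) \<gamma> = lower_last_two (theta_coeff f) \<gamma>"
proof (induction \<gamma> arbitrary: f)
  case Nil
  thus ?case by (simp add: lower_last_two_def)
next
  case (Cons m \<gamma>)
  hence m: "0 < m" "is_composition \<gamma>" by (auto simp: is_composition_def)
  show ?case
  proof (cases "\<gamma> = []")
    case True
    thus ?thesis using theta_block_lower_last_two[of m f "[]"]
      by simp (simp add: lower_last_two_def)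
  next
    case False
    have "theta_coeff (lower_last_two f) (m # \<gamma>) = theta_coeff (lower_last_two (theta_block m f)) \<gamma>"
      unfolding theta_coeff.simps
      by (rule theta_coeff_cong_nonempty) (use False m in \<open>auto simp: theta_block_lower_last_two\<close>)
    thus ?thesis using Cons.IH[OF m(2)] False by (simp add: lower_last_two_Cons)
  qed
qed

section \<open>The fundamental basis\<close>

text \<open>
  The coefficient function of the fundamental function $F_S^{(n+1)}$, with an offset: \<open>\<beta>\<close>
  describes the part of a composition that starts at position \<open>a\<close>. The offset makes the function
  closed under peeling off first parts.
\<close>

definition coarsening :: "nat \<Rightarrow> nat set \<Rightarrow> nat \<Rightarrow> nat list \<Rightarrow> rat"
  where "coarsening n S a \<beta> =
    of_bool (a + sum_list \<beta> = n + 1 \<and> S \<inter> {a<..n} \<subseteq> set (partial_sums a \<beta>))"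

text \<open>
  The factor picked up when a first part \<open>i\<close> is peeled off at offset \<open>a\<close>.
\<close>

definition gap_free :: "nat set \<Rightarrow> nat \<Rightarrow> nat \<Rightarrow> rat"
  where "gap_free S a i = of_bool (S \<inter> {a<..<a + i} = {})"

text \<open>
  The factor picked up when $z_m$ is peeled off at offset \<open>a\<close>: the positions of \<open>S\<close> strictly
  inside the block have to be an initial run of the block.
\<close>

definition run_weight :: "nat set \<Rightarrow> nat \<Rightarrow> nat \<Rightarrow> rat"
  where "run_weight S a m =
    (if m = 0 then 1 else 2 * of_bool (\<forall>x\<in>S. a + 1 < x \<and> x < a + m \<longrightarrow> x - 1 \<in> S))"

lemma partial_sums_ge: "x \<in> set (partial_sums a \<beta>) \<Longrightarrow> a \<le> x"
  by (induction \<beta> arbitrary: a) force+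

lemma partial_sums_gt: "is_composition \<beta> \<Longrightarrow> x \<in> set (partial_sums a \<beta>) \<Longrightarrow> a < x"
  using strict_sorted_partial_sums[of \<beta> a] by auto

lemma front_coarsening:
  assumes "S \<subseteq> {..n}"
  shows "front i (coarsening n S a) \<delta> = gap_free S a i * coarsening n S (a + i) \<delta>"
proof (cases "i = 0 \<or> n + 1 \<noteq> a + i + sum_list \<delta>")
  case True
  thus ?thesis by (auto simp: gap_free_def coarsening_def front_def)
next
  case False
  hence "S \<inter> {a<..n} = S \<inter> {a<..<a + i} \<union> (S \<inter> {a + i} \<union> S \<inter> {a + i<..n})"
    using assms by auto
  moreover have "S \<inter> {a<..<a + i} \<inter> set (partial_sums (a + i) \<delta>) = {}"
    using partial_sums_ge by fastforce
  ultimately show ?thesis using False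
    by (auto simp: gap_free_def coarsening_def front_def)
qed

text \<open>
  The relation $y(-t) z(t) = y(t)$ for the scalars by which $y_i$ and $z_m$ act on a fundamental
  function; it determines the second family from the first. Splitting off the summand \<open>i = 0\<close>
  reduces the sum to offset \<open>a + 1\<close>. If position \<open>a + 1\<close> is in \<open>S\<close>, then only one further summand
  survives; if not, then the remaining sum is the induction hypothesis.
\<close>

lemma run_weight_recursion:
  "(\<Sum>i\<le>m. (-1) ^ i * gap_free S a i * run_weight S (a + i) (m - i)) = gap_free S a m"
proof (induction m arbitrary: a)
  case 0
  show ?case by (simp add: gap_free_def run_weight_def)
next
  case (Suc m)
  have "(\<Sum>i\<le>Suc m. (-1) ^ i * gap_free S a i * run_weight S (a + i) (Suc m - i)) =
     run_weight S a (Suc m) - (\<Sum>i\<le>m. (-1) ^ i * gap_free S a (Suc i) * run_weight S (Suc a + i) (m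
         - i))"
    unfolding sum.atMost_Suc_shift by (simp add: gap_free_def sum_negf)
  also have "\<dots> = gap_free S a (Suc m)"
  proof (cases "a + 1 \<in> S")
    case True
    have "(\<Sum>i\<le>m. (-1) ^ i * gap_free S a (Suc i) * run_weight S (Suc a + i) (m - i)) =
      (\<Sum>i\<in>{0}. (-1) ^ i * gap_free S a (Suc i) * run_weight S (Suc a + i) (m - i))"
      by (rule sum.mono_neutral_right) (use True in \<open>auto simp: gap_free_def intro!: bexI[of _ "a
          + 1"]\<close>)
    also have "\<dots> = run_weight S (Suc a) m"
      by (auto simp: gap_free_def)
    finally have *: "(\<Sum>i\<le>m. (-1) ^ i * gap_free S a (Suc i) * run_weight S (Suc a + i) (m - i)) =
      run_weight S (Suc a) m" .
    show ?thesis
    proof (cases "m = 0")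
      case True
      thus ?thesis unfolding * by (auto simp: run_weight_def gap_free_def)
    next
      case False
      have "(\<forall>x\<in>S. a + 1 < x \<and> x < a + Suc m \<longrightarrow> x - 1 \<in> S) \<longleftrightarrow>
        (\<forall>x\<in>S. Suc a + 1 < x \<and> x < Suc a + m \<longrightarrow> x - 1 \<in> S)"
      proof (intro iffI ballI impI)
        fix x assume *: "\<forall>x\<in>S. Suc a + 1 < x \<and> x < Suc a + m \<longrightarrow> x - 1 \<in> S"
          and x: "x \<in> S" "a + 1 < x \<and> x < a + Suc m"
        show "x - 1 \<in> S"
        proof (cases "x = Suc a + 1")
          case False
          thus ?thesis using bspec[OF * x(1)] x(2) by simp
        qed (use True in simp)
      qed auto
      moreover have "gap_free S a (Suc m) = 0"
        using True False by (auto simp: gap_free_def intro!: bexI[of _ "a + 1"])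
      ultimately show ?thesis unfolding * using False by (simp add: run_weight_def)
    qed
  next
    case False
    have gf: "gap_free S a (Suc i) = gap_free S (Suc a) i" for i
    proof -
      have "S \<inter> {a<..<a + Suc i} = S \<inter> {Suc a<..<Suc a + i}"
        using False by (auto; metis Suc_lessI)
      thus ?thesis by (simp add: gap_free_def)
    qed
    have "(\<forall>x\<in>S. a + 1 < x \<and> x < a + Suc m \<longrightarrow> x - 1 \<in> S) \<longleftrightarrow> S \<inter> {Suc a<..<Suc a + m} = {}"
    proof
      assume *: "\<forall>x\<in>S. a + 1 < x \<and> x < a + Suc m \<longrightarrow> x - 1 \<in> S"
      have "x \<notin> S" if "Suc a \<le> x" "x < Suc a + m" for x
        using that
      proof (induction x rule: dec_induct)
        case base
        show ?case using False by simp
      next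
        case (step k)
        thus ?case using * by force
      qed
      thus "S \<inter> {Suc a<..<Suc a + m} = {}" by auto
    qed auto
    hence "run_weight S a (Suc m) = 2 * gap_free S (Suc a) m"
      by (simp add: run_weight_def gap_free_def)
    thus ?thesis unfolding gf Suc.IH by simp
  qed
  finally show ?case .
qed

lemma theta_block_coarsening:
  assumes "S \<subseteq> {..n}"
  shows "theta_block m (coarsening n S a) \<delta> = run_weight S a m * coarsening n S (a + m) \<delta>"
proof (induction m arbitrary: a rule: less_induct)
  case (less m)
  show ?case
  proof (cases "m = 0")
    case False
    hence e: "{..m} = insert 0 {1..m}" by auto
    have fr: "front i (coarsening n S a) = (\<lambda>\<delta>. gap_free S a i * coarsening n S (a + i) \<delta>)" for i
      using front_coarsening[OF assms] by auto
    define s where "s = (\<Sum>i\<in>{1..m}. (-1) ^ i * gap_free S a i * run_weight S (a + i) (m - i))"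
    have "(\<Sum>i\<in>{1..m}. (-1) ^ i * theta_block (m - i) (front i (coarsening n S a)) \<delta>) =
      s * coarsening n S (a + m) \<delta>"
      unfolding sum_distrib_right s_def
      by (intro sum.cong refl) (simp add: fr theta_block_scale less.IH)
    hence "theta_block m (coarsening n S a) \<delta> = (gap_free S a m - s) * coarsening n S (a + m) \<delta>"
      using theta_block_sum[of m "coarsening n S a" \<delta>] front_coarsening[OF assms, of m a \<delta>]
      unfolding e by (simp add: algebra_simps)
    moreover have "run_weight S a m = gap_free S a m - s"
      using run_weight_recursion[of S a m] unfolding e s_def by (simp add: gap_free_def[of S a 0])
    ultimately show ?thesis by simp
  qed (simp add: run_weight_def)
qed

text \<open>
  Beyond position \<open>a\<close> the runs of \<open>S\<close> have to start at a partial sum of \<open>\<gamma>\<close> or right after one, where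
  \<open>a\<close> counts as a partial sum. For \<open>a = 0\<close> this is the condition in the definition of
  $\Theta_{\Lambda(S)}$.
\<close>

lemma theta_coeff_coarsening:
  assumes "S \<subseteq> {..n}" "is_composition \<gamma>"
  shows "theta_coeff (coarsening n S a) \<gamma> = 2 ^ length \<gamma> * of_bool (a + sum_list \<gamma> = n + 1 \<and>
    (\<forall>x\<in>S. a + 1 < x \<longrightarrow> x - 1 \<notin> S \<longrightarrow> x \<in> set (partial_sums a \<gamma>) \<union> Suc ` set (partial_sums a \<gamma>)))"
  using assms(2)
proof (induction \<gamma> arbitrary: a)
  case Nil
  thus ?case using assms(1) by (auto simp: coarsening_def)
next
  case (Cons m \<gamma>)
  hence m: "0 < m" "is_composition \<gamma>" by (auto simp: is_composition_def)
  let ?P = "\<lambda>a \<gamma>. set (partial_sums a \<gamma>)"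
  let ?Q = "\<lambda>a \<gamma>. \<forall>x\<in>S. a + 1 < x \<longrightarrow> x - 1 \<notin> S \<longrightarrow> x \<in> ?P a \<gamma> \<union> Suc ` ?P a \<gamma>"
  have "theta_coeff (coarsening n S a) (m # \<gamma>) =
    run_weight S a m * theta_coeff (coarsening n S (a + m)) \<gamma>"
  proof -
    have "theta_block m (coarsening n S a) = (\<lambda>\<delta>. run_weight S a m * coarsening n S (a + m) \<delta>)"
      by (rule ext) (rule theta_block_coarsening[OF assms(1)])
    thus ?thesis using theta_coeff_scale[of "run_weight S a m" "coarsening n S (a + m)" \<gamma>] by simp
  qed
  note eq = this
  have "?Q a (m # \<gamma>) \<longleftrightarrow> (\<forall>x\<in>S. a + 1 < x \<and> x < a + m \<longrightarrow> x - 1 \<in> S) \<and> ?Q (a + m) \<gamma>"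
  proof (intro iffI conjI ballI impI)
    assume Q: "?Q a (m # \<gamma>)"
    fix x assume x: "x \<in> S"
    { assume x': "a + 1 < x \<and> x < a + m"
      have "x \<notin> ?P a (m # \<gamma>) \<union> Suc ` ?P a (m # \<gamma>)"
        using x' partial_sums_ge[of _ "a + m" \<gamma>] by fastforce
      thus "x - 1 \<in> S" using bspec[OF Q x] x' by blast }
    { assume x': "a + m + 1 < x" "x - 1 \<notin> S"
      hence "x \<in> ?P a (m # \<gamma>) \<union> Suc ` ?P a (m # \<gamma>)" using bspec[OF Q x] by simp
      moreover have "x \<noteq> a + m" "x \<noteq> Suc (a + m)" using x' by auto
      ultimately show "x \<in> ?P (a + m) \<gamma> \<union> Suc ` ?P (a + m) \<gamma>" by simp }
  next
    assume Q: "(\<forall>x\<in>S. a + 1 < x \<and> x < a + m \<longrightarrow> x - 1 \<in> S) \<and> ?Q (a + m) \<gamma>"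
    fix x assume x: "x \<in> S" "a + 1 < x" "x - 1 \<notin> S"
    consider "x < a + m" | "x = a + m" | "x = Suc (a + m)" | "a + m + 1 < x" by linarith
    thus "x \<in> ?P a (m # \<gamma>) \<union> Suc ` ?P a (m # \<gamma>)"
    proof cases
      case 1
      hence "x - 1 \<in> S" using bspec[OF conjunct1[OF Q] x(1)] x(2) by simp
      thus ?thesis using x(3) by contradiction
    next
      case 4
      hence "x \<in> ?P (a + m) \<gamma> \<union> Suc ` ?P (a + m) \<gamma>" using bspec[OF conjunct2[OF Q] x(1)] x(3) by
          simp
      thus ?thesis by auto
    qed simp_all
  qed
  note Q = this
  define I where "I \<longleftrightarrow> (\<forall>x\<in>S. a + 1 < x \<and> x < a + m \<longrightarrow> x - 1 \<in> S)"
  define Q' where "Q' \<longleftrightarrow> ?Q (a + m) \<gamma>"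
  have "theta_coeff (coarsening n S a) (m # \<gamma>) = 2 * of_bool I * (2 ^ length \<gamma> * of_bool (a + m +
      sum_list \<gamma> = n + 1 \<and> Q'))"
    unfolding eq Cons.IH[OF m(2)] run_weight_def I_def Q'_def using m(1) by (simp only: if_False
        refl neq0_conv[symmetric] not_False_eq_True split: if_split)
  also have "\<dots> = 2 ^ length (m # \<gamma>) * of_bool (a + sum_list (m # \<gamma>) = n + 1 \<and> I \<and> Q')"
    by (cases I; cases Q'; simp only: list.size sum_list.Cons add.assoc) simp_all
  also have "(I \<and> Q') = ?Q a (m # \<gamma>)" unfolding I_def Q'_def by (rule Q[symmetric])
  finally show ?case .
qed

section \<open>Coefficients of quasisymmetric functions\<close>

text \<open>
  The coefficient at a weak composition, in which parts 0 are admitted: splitting a monomial into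
  two factors, or one exponent into two, leads to exponents 0.
\<close>

definition wcoeff :: "series \<Rightarrow> nat list \<Rightarrow> rat"
  where "wcoeff F \<alpha> = coeff F (quasi_monom [0..<length \<alpha>] \<alpha>)"

abbreviation nonzeros :: "nat list \<Rightarrow> nat list"
  where "nonzeros \<equiv> filter ((<) 0)"

lemma nonzeros_composition: "is_composition (nonzeros \<alpha>)"
  by (simp add: is_composition_def)

lemma nonzeros_id: "is_composition \<alpha> \<Longrightarrow> nonzeros \<alpha> = \<alpha>"
  by (induction \<alpha>) (auto simp: is_composition_def)

lemma quasi_monom_Cons [simp]:
  "quasi_monom (i # is) (b # \<beta>) = Poly_Mapping.single i b + quasi_monom is \<beta>"
  by (simp add: quasi_monom_def)

lemma quasi_monom_Nil [simp]: "quasi_monom [] \<beta> = 0" "quasi_monom is [] = 0"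
  by (simp_all add: quasi_monom_def)

lemma quasi_monom_nonzeros:
  assumes "sorted_wrt (<) is" "length is = length \<alpha>"
  shows "\<exists>js. sorted_wrt (<) js \<and> set js \<subseteq> set is \<and> length js = length (nonzeros \<alpha>) \<and>
    quasi_monom is \<alpha> = quasi_monom js (nonzeros \<alpha>)"
  using assms
proof (induction "is" arbitrary: \<alpha>)
  case (Cons i "is")
  then obtain b \<beta> where \<alpha>: "\<alpha> = b # \<beta>" by (cases \<alpha>) auto
  obtain js where js: "sorted_wrt (<) js" "set js \<subseteq> set is" "length js = length (nonzeros \<beta>)"
    "quasi_monom is \<beta> = quasi_monom js (nonzeros \<beta>)"
    using Cons.IH[of \<beta>] Cons.prems by (auto simp: \<alpha>)
  show ?case
  proof (cases "b = 0")
    case True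
    thus ?thesis using js by (intro exI[of _ js]) (auto simp: \<alpha>)
  next
    case False
    thus ?thesis using js Cons.prems(1) by (intro exI[of _ "i # js"]) (auto simp: \<alpha>)
  qed
qed auto

lemma coeff_M_quasi_monom:
  assumes "is_composition \<beta>" "sorted_wrt (<) is" "length is = length \<alpha>"
  shows "coeff (M \<beta>) (quasi_monom is \<alpha>) = of_bool (nonzeros \<alpha> = \<beta>)"
proof -
  obtain js where js: "sorted_wrt (<) js" "length js = length (nonzeros \<alpha>)"
    "quasi_monom is \<alpha> = quasi_monom js (nonzeros \<alpha>)"
    using quasi_monom_nonzeros[OF assms(2,3)] by blast
  have "nonzeros \<alpha> = \<beta>" if "sorted_wrt (<) ks" "length ks = length \<beta>"
    "quasi_monom js (nonzeros \<alpha>) = quasi_monom ks \<beta>" for ks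
    using quasi_monom_unique[OF js(1,2) nonzeros_composition] quasi_monom_unique[OF that(1,2)
        assms(1)]
      that(3) by metis
  thus ?thesis using js by (auto simp: M_def)
qed

text \<open>
  Because of this, coefficients at monomials of the form \<open>quasi_monom is \<beta>\<close> determine a series.
\<close>

lemma monomial_eq_quasi_monom:
  obtains "is" \<beta> where "sorted_wrt (<) is" "length is = length \<beta>" "is_composition \<beta>" "m =
      quasi_monom is \<beta>"
proof -
  define js where "js = sorted_list_of_set (Poly_Mapping.keys m)"
  define \<beta> where "\<beta> = map (Poly_Mapping.lookup m) js"
  have js: "sorted_wrt (<) js" "distinct js" "set js = Poly_Mapping.keys m"
    by (simp_all add: js_def)
  have len: "length js = length \<beta>" by (simp add: \<beta>_def)
  have "m = quasi_monom js \<beta>"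
  proof (rule poly_mapping_eqI)
    fix k
    show "Poly_Mapping.lookup m k = Poly_Mapping.lookup (quasi_monom js \<beta>) k"
    proof (cases "k \<in> set js")
      case True
      thus ?thesis using map_lookup_quasi_monom[OF js(2) len] by (simp add: \<beta>_def)
    next
      case False
      thus ?thesis using lookup_quasi_monom_notin[OF False] js(3) by (simp add: in_keys_iff)
    qed
  qed
  moreover have "is_composition \<beta>"
    using js(3) by (auto simp: \<beta>_def is_composition_def in_keys_iff)
  ultimately show ?thesis using that js len by blast
qed

definition quasisymmetric :: "series \<Rightarrow> bool"
  where "quasisymmetric F \<longleftrightarrow> (\<forall>is \<alpha>. sorted_wrt (<) is \<longrightarrow> length is = length \<alpha> \<longrightarrow>
    coeff F (quasi_monom is \<alpha>) = wcoeff F (nonzeros \<alpha>))"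

definition support :: "series \<Rightarrow> nat list set"
  where "support F = {\<beta>. is_composition \<beta> \<and> wcoeff F \<beta> \<noteq> 0}"

lemma wcoeff_simps [simp]:
  "wcoeff 0 \<alpha> = 0" "wcoeff (F + G) \<alpha> = wcoeff F \<alpha> + wcoeff G \<alpha>"
  "wcoeff (scale c F) \<alpha> = c * wcoeff F \<alpha>" "wcoeff (sum f A) \<alpha> = (\<Sum>x\<in>A. wcoeff (f x) \<alpha>)"
  "wcoeff (F - G) \<alpha> = wcoeff F \<alpha> - wcoeff G \<alpha>"
  by (simp_all add: wcoeff_def coeff_sum)

lemma wcoeff_M: "is_composition \<beta> \<Longrightarrow> wcoeff (M \<beta>) \<alpha> = of_bool (nonzeros \<alpha> = \<beta>)"
  unfolding wcoeff_def by (rule coeff_M_quasi_monom) auto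

lemma wcoeff_one: "wcoeff 1 \<alpha> = of_bool (nonzeros \<alpha> = [])"
  using wcoeff_M[of "[]" \<alpha>] by (simp add: M_Nil is_composition_def)

lemma quasisymmetric_M: "is_composition \<beta> \<Longrightarrow> quasisymmetric (M \<beta>)"
  by (simp add: quasisymmetric_def coeff_M_quasi_monom wcoeff_M)

lemma subspace_QSym: "qs.subspace QSym"
  by (simp add: QSym_def)

lemma M_in_QSym: "is_composition \<beta> \<Longrightarrow> M \<beta> \<in> QSym"
  by (simp add: QSym_def qs.span_base)

lemma QSym_quasisymmetric:
  assumes "F \<in> QSym"
  shows "quasisymmetric F" "finite (support F)"
proof -
  have "quasisymmetric F \<and> finite (support F)"
    using assms unfolding QSym_def
  proof (induction rule: qs.span_induct_alt)
    case base
    show ?case by (simp add: quasisymmetric_def support_def)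
  next
    case (step c x y)
    then obtain \<beta> where \<beta>: "is_composition \<beta>" "x = M \<beta>" by auto
    have "support (scale c x + y) \<subseteq> insert \<beta> (support y)"
      using \<beta> nonzeros_id by (auto simp: support_def wcoeff_M)
    moreover have "quasisymmetric (scale c x + y)"
      using quasisymmetric_M[OF \<beta>(1)] step by (simp add: quasisymmetric_def \<beta>)
    ultimately show ?case using step by (auto intro: finite_subset)
  qed
  thus "quasisymmetric F" "finite (support F)" by auto
qed

lemma quasisymmetric_eqI:
  assumes "quasisymmetric F" "quasisymmetric G" "\<And>\<beta>. is_composition \<beta> \<Longrightarrow> wcoeff F \<beta> = wcoeff G \<beta>"
  shows "F = G"
proof (rule series_eqI)
  fix m
  obtain "is" \<beta> where m: "sorted_wrt (<) is" "length is = length \<beta>" "is_composition \<beta>" "m =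
      quasi_monom is \<beta>"
    by (rule monomial_eq_quasi_monom)
  thus "coeff F m = coeff G m"
    using assms nonzeros_id[OF m(3)] by (simp add: quasisymmetric_def)
qed

lemma quasisymmetric_expansion:
  assumes "quasisymmetric F" "finite (support F)"
  shows "F = (\<Sum>\<beta>\<in>support F. scale (wcoeff F \<beta>) (M \<beta>))" (is "F = ?G")
proof (rule quasisymmetric_eqI[OF assms(1)])
  have "?G \<in> QSym"
    by (intro qs.subspace_sum[OF subspace_QSym] qs.subspace_scale[OF subspace_QSym] M_in_QSym)
       (simp add: support_def)
  thus "quasisymmetric ?G" by (rule QSym_quasisymmetric)
  fix \<beta> assume \<beta>: "is_composition \<beta>"
  have "wcoeff ?G \<beta> = (\<Sum>\<gamma>\<in>support F. if \<gamma> = \<beta> then wcoeff F \<beta> else 0)"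
    unfolding wcoeff_simps
    using nonzeros_id[OF \<beta>] by (intro sum.cong refl) (auto simp: support_def wcoeff_M)
  thus "wcoeff F \<beta> = wcoeff ?G \<beta>"
    using assms(2) \<beta> by (auto simp: support_def)
qed

lemma QSym_iff: "F \<in> QSym \<longleftrightarrow> quasisymmetric F \<and> finite (support F)"
proof
  assume "quasisymmetric F \<and> finite (support F)"
  hence "F = (\<Sum>\<beta>\<in>support F. scale (wcoeff F \<beta>) (M \<beta>))"
    using quasisymmetric_expansion by blast
  also have "\<dots> \<in> QSym"
    by (intro qs.subspace_sum[OF subspace_QSym] qs.subspace_scale[OF subspace_QSym] M_in_QSym)
       (simp add: support_def)
  finally show "F \<in> QSym" .
qed (use QSym_quasisymmetric in blast)

lemma wcoeff_nonzeros: "F \<in> QSym \<Longrightarrow> wcoeff F (nonzeros \<alpha>) = wcoeff F \<alpha>"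
  using QSym_quasisymmetric(1)[of F] unfolding quasisymmetric_def
  by (metis length_upt minus_nat.diff_0 strict_sorted_iff sorted_wrt_upt wcoeff_def)

section \<open>The coefficients of $\vartheta(F)$\<close>

lemma last_partial_sums: "\<beta> \<noteq> [] \<Longrightarrow> last (partial_sums a \<beta>) = a + sum_list \<beta>"
proof (induction \<beta> arbitrary: a)
  case (Cons b \<beta>)
  thus ?case by (cases \<beta>) auto
qed simp

lemma partial_sums_le: "x \<in> set (partial_sums a \<beta>) \<Longrightarrow> x \<le> a + sum_list \<beta>"
  by (induction \<beta> arbitrary: a) force+

lemma length_partial_sums [simp]: "length (partial_sums a \<beta>) = length \<beta>"
  by (induction \<beta> arbitrary: a) auto

lemma composition_of_set:
  assumes "S \<subseteq> {1..n}"
  shows "sum_list (composition_of n S) = n + 1" "S = set (partial_sums 0 (composition_of n S)) -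
      {n + 1}"
proof -
  have "finite S" using assms by (rule finite_subset) simp
  note ps = partial_sums_composition_of[OF assms]
  show "sum_list (composition_of n S) = n + 1"
    using last_partial_sums[OF composition_of_nonempty, of 0 n S] by (simp add: ps)
  show "S = set (partial_sums 0 (composition_of n S)) - {n + 1}"
    using assms \<open>finite S\<close> by (auto simp: ps)
qed

lemma composition_of_eq_iff:
  assumes "S \<subseteq> {1..n}" "is_composition \<beta>"
  shows "composition_of n S = \<beta> \<longleftrightarrow> sum_list \<beta> = n + 1 \<and> S = set (partial_sums 0 \<beta>) - {n + 1}"
proof
  assume "sum_list \<beta> = n + 1 \<and> S = set (partial_sums 0 \<beta>) - {n + 1}"
  moreover from this have "\<beta> \<noteq> []" by auto
  then obtain k T where "T \<subseteq> {1..k}" "\<beta> = composition_of k T"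
    using composition_of_surj[OF assms(2)] by blast
  ultimately show "composition_of n S = \<beta>"
    using composition_of_set by (metis add_right_cancel)
qed (use composition_of_set[OF assms(1)] in auto)

lemma wcoeff_MS:
  assumes "S \<subseteq> {1..n}" "is_composition \<beta>"
  shows "wcoeff (MS n S) \<beta> = of_bool (sum_list \<beta> = n + 1 \<and> S = set (partial_sums 0 \<beta>) - {n + 1})"
  unfolding MS_def wcoeff_M[OF composition_of_is_composition[OF assms(1)]] nonzeros_id[OF assms(2)]
    composition_of_eq_iff[OF assms, symmetric] by (simp add: eq_commute)

lemma wcoeff_sum_MS:
  assumes "finite A" "\<And>S. S \<in> A \<Longrightarrow> S \<subseteq> {1..n}" "is_composition \<beta>"
  defines "T \<equiv> set (partial_sums 0 \<beta>) - {n + 1}"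
  shows "wcoeff (\<Sum>S\<in>A. scale (u S) (MS n S)) \<beta> = (if sum_list \<beta> = n + 1 \<and> T \<in> A then u T else 0)"
proof -
  have "wcoeff (\<Sum>S\<in>A. scale (u S) (MS n S)) \<beta> =
    (\<Sum>S\<in>A. if S = T then (if sum_list \<beta> = n + 1 then u T else 0) else 0)"
    unfolding wcoeff_simps
  proof (intro sum.cong refl)
    fix S assume "S \<in> A"
    hence "wcoeff (MS n S) \<beta> = of_bool (sum_list \<beta> = n + 1 \<and> S = T)"
      unfolding T_def by (rule wcoeff_MS[OF assms(2) assms(3)])
    thus "u S * wcoeff (MS n S) \<beta> = (if S = T then if sum_list \<beta> = n + 1 then u T else 0 else 0)"
      by (simp split: if_splits)
  qed
  thus ?thesis using assms(1) by simp
qed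

lemma partial_sums_inner:
  assumes "is_composition \<beta>" "sum_list \<beta> = n + 1"
  shows "set (partial_sums 0 \<beta>) - {n + 1} \<subseteq> {1..n}" "n + 1 \<in> set (partial_sums 0 \<beta>)"
    "card (set (partial_sums 0 \<beta>) - {n + 1}) + 1 = length \<beta>"
proof -
  have ne: "\<beta> \<noteq> []" using assms(2) by auto
  show "set (partial_sums 0 \<beta>) - {n + 1} \<subseteq> {1..n}"
    using partial_sums_gt[OF assms(1), of _ 0] partial_sums_le[of _ 0 \<beta>] assms(2) by fastforce
  show 1: "n + 1 \<in> set (partial_sums 0 \<beta>)"
    using last_partial_sums[OF ne, of 0] assms(2) ne
    by (metis add_0 last_in_set length_0_conv length_partial_sums)
  have "distinct (partial_sums 0 \<beta>)"
    using strict_sorted_partial_sums[OF assms(1), of 0] strict_sorted_iff by auto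
  thus "card (set (partial_sums 0 \<beta>) - {n + 1}) + 1 = length \<beta>"
    using 1 by (metis Suc_eq_plus1 card.remove distinct_card length_partial_sums List.finite_set)
qed

lemma wcoeff_FS:
  assumes "S \<subseteq> {1..n}" "is_composition \<beta>"
  shows "wcoeff (FS n S) \<beta> = coarsening n S 0 \<beta>"
proof -
  have eq: "FS n S = (\<Sum>T | S \<subseteq> T \<and> T \<subseteq> {1..n}. scale 1 (MS n T))"
    by (simp add: FS_def)
  have "S \<inter> {0<..n} = S" using assms(1) by auto
  thus ?thesis unfolding eq
    using partial_sums_inner(1)[OF assms(2)] assms(1)
    by (subst wcoeff_sum_MS) (use assms(2) in \<open>auto simp: coarsening_def\<close>)
qed

lemma wcoeff_\<Theta>:
  assumes "S \<subseteq> {1..n}" "is_composition \<beta>"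
  shows "wcoeff (\<Theta> n S) \<beta> = 2 ^ length \<beta> * of_bool (sum_list \<beta> = n + 1 \<and>
    S \<subseteq> set (partial_sums 0 \<beta>) \<union> Suc ` set (partial_sums 0 \<beta>))"
proof (cases "sum_list \<beta> = n + 1")
  case True
  let ?T = "set (partial_sums 0 \<beta>) - {n + 1}"
  have "S \<subseteq> ?T \<union> (\<lambda>i. i + 1) ` ?T \<longleftrightarrow> S \<subseteq> set (partial_sums 0 \<beta>) \<union> Suc ` set (partial_sums 0 \<beta>)"
    using assms(1) by fastforce
  thus ?thesis unfolding \<Theta>_def
    using partial_sums_inner[OF assms(2) True] True
    by (subst wcoeff_sum_MS) (use assms(2) in auto)
next
  case False
  thus ?thesis unfolding \<Theta>_def
    by (subst wcoeff_sum_MS) (use assms(2) in auto)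
qed

lemma MS_in_QSym: "S \<subseteq> {1..n} \<Longrightarrow> MS n S \<in> QSym"
  by (simp add: MS_def M_in_QSym composition_of_is_composition)

lemma FS_in_QSym: "FS n S \<in> QSym"
  unfolding FS_def by (intro qs.subspace_sum[OF subspace_QSym] MS_in_QSym) auto

lemma \<Theta>_in_QSym: "\<Theta> n S \<in> QSym"
  unfolding \<Theta>_def
  by (intro qs.subspace_sum[OF subspace_QSym] qs.subspace_scale[OF subspace_QSym] MS_in_QSym) auto

lemma one_in_QSym: "1 \<in> QSym"
  using M_in_QSym[of "[]"] by (simp add: M_Nil is_composition_def)

lemma QSym_span_FS: "QSym = qs.span (insert 1 {FS n S | n S. S \<subseteq> {1..n}})"
proof
  show "qs.span (insert 1 {FS n S | n S. S \<subseteq> {1..n}}) \<subseteq> QSym"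
    by (rule qs.span_minimal[OF _ subspace_QSym]) (auto simp: one_in_QSym FS_in_QSym)
  have "M \<beta> \<in> qs.span (insert 1 {FS n S | n S. S \<subseteq> {1..n}})" if \<beta>: "is_composition \<beta>" for \<beta>
  proof (cases "\<beta> = []")
    case True
    thus ?thesis by (simp add: M_Nil qs.span_base)
  next
    case False
    then obtain n S where S: "S \<subseteq> {1..n}" "M \<beta> = MS n S"
      using composition_of_surj[OF \<beta>] unfolding MS_def by metis
    show ?thesis unfolding S(2) FS_inversion[OF S(1)]
      by (intro qs.span_sum qs.span_scale qs.span_base) auto
  qed
  thus "QSym \<subseteq> qs.span (insert 1 {FS n S | n S. S \<subseteq> {1..n}})"
    unfolding QSym_def by (intro qs.span_minimal) auto
qed

lemma linear_\<theta>: "linear_map \<theta>" and \<theta>_one: "\<theta> 1 = 1"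
  and \<theta>_FS: "S \<subseteq> {1..n} \<Longrightarrow> \<theta> (FS n S) = \<Theta> n (\<Lambda> S)"
  using is_\<theta>_\<theta> by (auto simp: is_\<theta>_def)

lemma linear_L: "linear_map L" and L_MS: "S \<subseteq> {1..n} \<Longrightarrow> L (MS n S) = MS (n + 1) S"
  using is_L_L by (auto simp: is_L_def)

lemmas \<theta>_linear = qs_pair.linear_add[OF linear_\<theta>] qs_pair.linear_scale[OF linear_\<theta>]
  qs_pair.linear_0[OF linear_\<theta>] qs_pair.linear_sum[OF linear_\<theta>]

lemmas L_linear = qs_pair.linear_add[OF linear_L] qs_pair.linear_scale[OF linear_L]
  qs_pair.linear_0[OF linear_L] qs_pair.linear_sum[OF linear_L]

lemma \<theta>_in_QSym: "F \<in> QSym \<Longrightarrow> \<theta> F \<in> QSym"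
  unfolding QSym_span_FS
proof (induction rule: qs.span_induct_alt)
  case base
  show ?case by (simp add: \<theta>_linear qs.span_zero)
next
  case (step c x y)
  have "\<theta> x \<in> QSym" using step(1) by (auto simp: \<theta>_one one_in_QSym \<theta>_FS \<Theta>_in_QSym)
  thus ?case using step(2) unfolding \<theta>_linear QSym_span_FS[symmetric]
    by (intro qs.subspace_add[OF subspace_QSym] qs.subspace_scale[OF subspace_QSym])
qed

text \<open>
  On the fundamental basis this is \<open>theta_coeff_coarsening\<close>; both sides are linear in $F$.
\<close>

lemma wcoeff_\<theta>_composition:
  assumes "is_composition \<gamma>" "F \<in> QSym"
  shows "wcoeff (\<theta> F) \<gamma> = theta_coeff (wcoeff F) \<gamma>"
  using assms(2) unfolding QSym_span_FS
proof (induction rule: qs.span_induct_alt)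
  case base
  have "wcoeff 0 = (\<lambda>_. 0)" by auto
  thus ?case by (simp add: \<theta>_linear theta_coeff_zero)
next
  case (step c x y)
  have "wcoeff (\<theta> x) \<gamma> = theta_coeff (wcoeff x) \<gamma>"
  proof (cases "x = 1")
    case True
    have *: "theta_block m (wcoeff 1) \<delta> = 0" if "0 < m" for m \<delta>
    proof -
      have "front i (wcoeff 1) = (\<lambda>_. 0)" if "0 < i" for i
        using that by (auto simp: front_pos' wcoeff_one)
      thus ?thesis using \<open>0 < m\<close> by (simp add: theta_block_pos theta_block_zero)
    qed
    show ?thesis
    proof (cases \<gamma>)
      case (Cons m \<delta>)
      hence "0 < m" using assms(1) by (auto simp: is_composition_def)
      hence "theta_block m (wcoeff 1) = (\<lambda>_. 0)" using * by auto
      thus ?thesis using Cons \<open>0 < m\<close> by (simp add: True \<theta>_one wcoeff_one theta_coeff_zero)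
    qed (simp add: True \<theta>_one)
  next
    case False
    then obtain n S where x: "x = FS n S" and S: "S \<subseteq> {1..n}" using step(1) by auto
    have "theta_coeff (wcoeff x) \<gamma> = theta_coeff (coarsening n S 0) \<gamma>"
      unfolding x by (rule theta_coeff_cong) (rule wcoeff_FS[OF S])
    also have "\<dots> = wcoeff (\<Theta> n (\<Lambda> S)) \<gamma>"
    proof -
      have "(\<forall>x\<in>S. 0 + 1 < x \<longrightarrow> x - 1 \<notin> S \<longrightarrow> x \<in> P) \<longleftrightarrow> \<Lambda> S \<subseteq> P" for P
        using S by (force simp: \<Lambda>_def)
      moreover have "\<Lambda> S \<subseteq> {1..n}" "S \<subseteq> {..n}" using S by (auto simp: \<Lambda>_def)
      ultimately show ?thesis using assms(1)
        by (simp only: theta_coeff_coarsening wcoeff_\<Theta> add_0)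
    qed
    finally show ?thesis by (simp add: x \<theta>_FS[OF S])
  qed
  moreover have "wcoeff (scale c x + y) = (\<lambda>\<delta>. c * wcoeff x \<delta> + wcoeff y \<delta>)" by auto
  ultimately show ?case using step(2) by (simp add: \<theta>_linear theta_coeff_linear)
qed

lemma wcoeff_\<theta>:
  assumes "F \<in> QSym"
  shows "wcoeff (\<theta> F) = theta_coeff (wcoeff F)"
proof
  fix \<gamma>
  show "wcoeff (\<theta> F) \<gamma> = theta_coeff (wcoeff F) \<gamma>"
    using wcoeff_\<theta>_composition[OF nonzeros_composition assms, of \<gamma>]
      wcoeff_nonzeros[OF \<theta>_in_QSym[OF assms]] theta_coeff_weak[of "wcoeff F" \<gamma>] by simp
qed

section \<open>Products of quasisymmetric functions\<close>

text \<open>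
  The convolution of coefficient functions that describes the product of quasisymmetric functions:
  every part of a weak composition is distributed over the two factors.
\<close>

fun conv :: "(nat list \<Rightarrow> rat) \<Rightarrow> (nat list \<Rightarrow> rat) \<Rightarrow> nat list \<Rightarrow> rat" where
  "conv f g [] = f [] * g []"
| "conv f g (b # \<beta>) = (\<Sum>i\<le>b. conv (\<lambda>\<delta>. f (i # \<delta>)) (\<lambda>\<delta>. g ((b - i) # \<delta>)) \<beta>)"

lemma conv_cong:
  "(\<And>\<alpha>. length \<alpha> = length \<beta> \<Longrightarrow> f \<alpha> = f' \<alpha>) \<Longrightarrow> (\<And>\<alpha>. length \<alpha> = length \<beta> \<Longrightarrow> g \<alpha> = g' \<alpha>) \<Longrightarrow>
   conv f g \<beta> = conv f' g' \<beta>"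
proof (induction \<beta> arbitrary: f g f' g')
  case (Cons b \<beta>)
  show ?case unfolding conv.simps
    by (intro sum.cong refl Cons.IH) (simp_all add: Cons.prems)
qed simp

lemma conv_linear_left:
  "conv (\<lambda>\<delta>. a * f \<delta> + f' \<delta>) g \<beta> = a * conv f g \<beta> + conv f' g \<beta>"
  by (induction \<beta> arbitrary: f f' g) (simp_all add: algebra_simps sum.distrib sum_distrib_left)

lemma conv_commute: "conv f g \<beta> = conv g f \<beta>"
proof (induction \<beta> arbitrary: f g)
  case (Cons b \<beta>)
  show ?case unfolding conv.simps
    by (rule sum.reindex_bij_witness[of _ "\<lambda>i. b - i" "\<lambda>i. b - i"]) (auto intro: Cons.IH)
qed simp

lemma conv_zero: "conv (\<lambda>_. 0) g \<beta> = 0" "conv f (\<lambda>_. 0) \<beta> = 0"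
proof -
  show *: "conv (\<lambda>_. 0) g \<beta> = 0" for g
    using conv_linear_left[of "-1" "\<lambda>_. 0" "\<lambda>_. 0" g \<beta>] by simp
  show "conv f (\<lambda>_. 0) \<beta> = 0" using *[of f] by (simp add: conv_commute)
qed

lemma conv_lincomb_left:
  "finite I \<Longrightarrow> conv (\<lambda>\<delta>. \<Sum>i\<in>I. a i * f i \<delta>) g \<beta> = (\<Sum>i\<in>I. a i * conv (f i) g \<beta>)"
proof (induction I rule: finite_induct)
  case (insert x F)
  thus ?case using conv_linear_left[of "a x" "f x" "\<lambda>\<delta>. \<Sum>i\<in>F. a i * f i \<delta>"] by simp
qed (simp add: conv_zero)

lemma conv_lincomb:
  assumes "finite I" "finite J"
  shows "conv (\<lambda>\<delta>. \<Sum>i\<in>I. a i * f i \<delta>) (\<lambda>\<delta>. \<Sum>j\<in>J. b j * g j \<delta>) \<beta> =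
    (\<Sum>i\<in>I. \<Sum>j\<in>J. a i * b j * conv (f i) (g j) \<beta>)"
proof -
  have "conv h (\<lambda>\<delta>. \<Sum>j\<in>J. b j * g j \<delta>) \<beta> = (\<Sum>j\<in>J. b j * conv h (g j) \<beta>)" for h
    using conv_lincomb_left[OF assms(2), of b g h \<beta>] by (simp add: conv_commute[of h])
  thus ?thesis by (simp add: conv_lincomb_left[OF assms(1)] sum_distrib_left mult.assoc)
qed

text \<open>
  Splitting off the variable \<open>i\<close>, whose exponent is distributed independently of the other ones.
\<close>

lemma sum_splittings:
  assumes "distinct is" "length is = length \<beta>"
  shows "(\<Sum>(a, b) | a + b = quasi_monom is \<beta>. f a * g b) =
    conv (\<lambda>\<alpha>. f (quasi_monom is \<alpha>)) (\<lambda>\<alpha>. g (quasi_monom is \<alpha>)) \<beta>"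
  using assms
proof (induction "is" arbitrary: \<beta> f g)
  case Nil
  have "{(a, b). a + b = (0 :: nat \<Rightarrow>\<^sub>0 nat)} = {(0, 0)}"
  proof -
    have "a + b = 0 \<longleftrightarrow> a = 0 \<and> b = 0" for a b :: "nat \<Rightarrow>\<^sub>0 nat"
      by (simp add: poly_mapping_eq_iff fun_eq_iff lookup_add) blast
    thus ?thesis by simp
  qed
  thus ?case using Nil by simp
next
  case (Cons i "is")
  then obtain b \<gamma> where \<beta>: "\<beta> = b # \<gamma>" "length is = length \<gamma>" by (cases \<beta>) auto
  let ?s = "Poly_Mapping.single i"
  let ?m = "quasi_monom is \<gamma>"
  have mi: "Poly_Mapping.lookup ?m i = 0"
    using Cons.prems by (intro lookup_quasi_monom_notin) auto
  have z: "Poly_Mapping.lookup x i = 0" "Poly_Mapping.lookup y i = 0" if "x + y = ?m" for x y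
    using mi that by (metis add_is_0 lookup_add)+
  have cancel: "?s (Poly_Mapping.lookup x i) + (x - ?s (Poly_Mapping.lookup x i)) = x" for x
    by (rule poly_mapping_eqI) (simp add: lookup_add lookup_minus lookup_single when_def)
  have "(\<Sum>(x, y) | x + y = ?s b + ?m. f x * g y) =
    (\<Sum>(j, x, y)\<in>(SIGMA j:{..b}. {(x, y). x + y = ?m}). f (?s j + x) * g (?s (b - j) + y))"
  proof (rule sum.reindex_bij_witness[of _
      "\<lambda>(j, x, y). (?s j + x, ?s (b - j) + y)"
      "\<lambda>(x, y). (Poly_Mapping.lookup x i, x - ?s (Poly_Mapping.lookup x i), y - ?s
          (Poly_Mapping.lookup y i))"], goal_cases)
    case (1 p)
    then obtain x y where p: "p = (x, y)" "x + y = ?s b + ?m" by auto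
    have "Poly_Mapping.lookup x i + Poly_Mapping.lookup y i = b"
      using arg_cong[OF p(2), of "\<lambda>m. Poly_Mapping.lookup m i"] mi by (simp add: lookup_add)
    hence "b - Poly_Mapping.lookup x i = Poly_Mapping.lookup y i" by simp
    thus ?case by (simp add: p cancel)
  next
    case (2 p)
    then obtain x y where p: "p = (x, y)" "x + y = ?s b + ?m" by auto
    have l: "Poly_Mapping.lookup x k + Poly_Mapping.lookup y k =
        Poly_Mapping.lookup (?s b) k + Poly_Mapping.lookup ?m k" for k
      using arg_cong[OF p(2), of "\<lambda>m. Poly_Mapping.lookup m k"] by (simp add: lookup_add)
    have "Poly_Mapping.lookup x i \<le> b" using l[of i] mi by simp
    moreover have "x - ?s (Poly_Mapping.lookup x i) + (y - ?s (Poly_Mapping.lookup y i)) = ?m"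
    proof (rule poly_mapping_eqI)
      fix k
      show "Poly_Mapping.lookup (x - ?s (Poly_Mapping.lookup x i) + (y - ?s (Poly_Mapping.lookup y
          i))) k =
          Poly_Mapping.lookup ?m k"
        using l[of k] mi by (cases "k = i") (auto simp: lookup_add lookup_minus lookup_single)
    qed
    ultimately show ?case by (simp add: p)
  next
    case (3 p)
    then obtain j x y where p: "p = (j, x, y)" "j \<le> b" "x + y = ?m" by auto
    thus ?case using z[OF p(3)] by (simp add: lookup_add)
  next
    case (4 p)
    then obtain j x y where p: "p = (j, x, y)" "j \<le> b" "x + y = ?m" by auto
    have "?s j + x + (?s (b - j) + y) = (?s j + ?s (b - j)) + (x + y)" by (simp add: ac_simps)
    also have "\<dots> = ?s b + ?m" using p by (simp flip: single_add)
    finally show ?case by (simp add: p)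
  next
    case (5 p)
    then obtain x y where p: "p = (x, y)" "x + y = ?s b + ?m" by auto
    have "Poly_Mapping.lookup x i + Poly_Mapping.lookup y i = b"
      using arg_cong[OF p(2), of "\<lambda>m. Poly_Mapping.lookup m i"] mi by (simp add: lookup_add)
    hence "b - Poly_Mapping.lookup x i = Poly_Mapping.lookup y i" by simp
    thus ?case by (simp add: p cancel)
  qed
  also have "\<dots> = (\<Sum>j\<le>b. \<Sum>(x, y) | x + y = ?m. f (?s j + x) * g (?s (b - j) + y))"
    by (subst sum.Sigma[symmetric]) (auto simp: finite_splittings)
  also have "\<dots> = (\<Sum>j\<le>b. conv (\<lambda>\<alpha>. f (?s j + quasi_monom is \<alpha>)) (\<lambda>\<alpha>. g (?s (b - j) + quasi_monom is
      \<alpha>)) \<gamma>)"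
    using Cons.prems \<beta>(2) by (intro sum.cong refl Cons.IH) auto
  finally show ?case by (simp add: \<beta>)
qed

lemma coeff_mult_conv:
  assumes "F \<in> QSym" "G \<in> QSym" "sorted_wrt (<) is" "length is = length \<beta>"
  shows "coeff (F * G) (quasi_monom is \<beta>) = conv (wcoeff F) (wcoeff G) \<beta>"
proof -
  have "distinct is" using assms(3) strict_sorted_iff by blast
  hence "coeff (F * G) (quasi_monom is \<beta>) =
    conv (\<lambda>\<alpha>. coeff F (quasi_monom is \<alpha>)) (\<lambda>\<alpha>. coeff G (quasi_monom is \<alpha>)) \<beta>"
    unfolding coeff_mult using sum_splittings[OF _ assms(4)] by blast
  also have "\<dots> = conv (wcoeff F) (wcoeff G) \<beta>"
    using QSym_quasisymmetric(1)[OF assms(1)] QSym_quasisymmetric(1)[OF assms(2)]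
      assms wcoeff_nonzeros unfolding quasisymmetric_def
    by (intro conv_cong) simp_all
  finally show ?thesis .
qed

lemma wcoeff_mult:
  "F \<in> QSym \<Longrightarrow> G \<in> QSym \<Longrightarrow> wcoeff (F * G) \<beta> = conv (wcoeff F) (wcoeff G) \<beta>"
  unfolding wcoeff_def[of "F * G"] by (rule coeff_mult_conv) auto

lemma conv_nonzeros:
  assumes "\<And>\<alpha>. f (nonzeros \<alpha>) = f \<alpha>" "\<And>\<alpha>. g (nonzeros \<alpha>) = g \<alpha>"
  shows "conv f g (nonzeros \<beta>) = conv f g \<beta>"
  using assms
proof (induction \<beta> arbitrary: f g)
  case (Cons b \<beta>)
  have tail: "h (i # nonzeros \<alpha>) = h (i # \<alpha>)" if "\<And>\<alpha>. h (nonzeros \<alpha>) = h \<alpha>" for h :: "nat list \<Rightarrow>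
      rat" and i \<alpha>
    using that[of "i # nonzeros \<alpha>"] that[of "i # \<alpha>"] by (simp split: if_splits)
  have IH: "conv (\<lambda>\<delta>. f (i # \<delta>)) (\<lambda>\<delta>. g (j # \<delta>)) (nonzeros \<beta>) = conv (\<lambda>\<delta>. f (i # \<delta>)) (\<lambda>\<delta>. g (j #
      \<delta>)) \<beta>" for i j
    by (rule Cons.IH) (rule tail, rule Cons.prems)+
  show ?case
  proof (cases "b = 0")
    case True
    have "(\<lambda>\<delta>. h (0 # \<delta>)) = h" if "\<And>\<alpha>. h (nonzeros \<alpha>) = h \<alpha>" for h :: "nat list \<Rightarrow> rat"
    proof
      fix \<delta> show "h (0 # \<delta>) = h \<delta>" using that[of "0 # \<delta>"] that[of \<delta>] by simp
    qed
    thus ?thesis using IH[of 0 0] Cons.prems True by simp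
  qed (simp add: IH)
qed simp

lemma conv_nonzero_splits:
  assumes "conv f g \<beta> \<noteq> 0"
  shows "\<exists>\<alpha> \<alpha>'. f \<alpha> \<noteq> 0 \<and> g \<alpha>' \<noteq> 0 \<and> sum_list \<beta> = sum_list \<alpha> + sum_list \<alpha>'"
  using assms
proof (induction \<beta> arbitrary: f g)
  case Nil
  thus ?case by (intro exI[of _ "[]"]) auto
next
  case (Cons b \<beta>)
  have "\<not> (\<forall>i\<in>{..b}. conv (\<lambda>\<delta>. f (i # \<delta>)) (\<lambda>\<delta>. g ((b - i) # \<delta>)) \<beta> = 0)"
    using Cons.prems unfolding conv.simps by (metis (no_types, lifting) sum.neutral)
  then obtain i where i: "i \<le> b" "conv (\<lambda>\<delta>. f (i # \<delta>)) (\<lambda>\<delta>. g ((b - i) # \<delta>)) \<beta> \<noteq> 0"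
    by blast
  from Cons.IH[OF i(2)] obtain \<alpha> \<alpha>' where "f (i # \<alpha>) \<noteq> 0" "g ((b - i) # \<alpha>') \<noteq> 0"
    "sum_list \<beta> = sum_list \<alpha> + sum_list \<alpha>'" by blast
  thus ?case using i(1) by (intro exI[of _ "i # \<alpha>"] exI[of _ "(b - i) # \<alpha>'"]) auto
qed

lemma sum_list_nonzeros: "sum_list (nonzeros \<alpha>) = sum_list \<alpha>"
  by (induction \<alpha>) auto

lemma QSym_bounded_degree:
  assumes "F \<in> QSym"
  obtains N where "\<And>\<alpha>. wcoeff F \<alpha> \<noteq> 0 \<Longrightarrow> sum_list \<alpha> \<le> N"
proof
  fix \<alpha> assume "wcoeff F \<alpha> \<noteq> 0"
  hence "nonzeros \<alpha> \<in> support F"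
    using wcoeff_nonzeros[OF assms] nonzeros_composition by (simp add: support_def)
  hence "sum_list (nonzeros \<alpha>) \<le> (\<Sum>\<beta>\<in>support F. sum_list \<beta>)"
    using QSym_quasisymmetric(2)[OF assms] by (intro member_le_sum) auto
  thus "sum_list \<alpha> \<le> (\<Sum>\<beta>\<in>support F. sum_list \<beta>)" by (simp add: sum_list_nonzeros)
qed

lemma length_le_sum_list: "is_composition \<beta> \<Longrightarrow> length \<beta> \<le> sum_list \<beta>"
  by (induction \<beta>) (auto simp: is_composition_def)

lemma finite_compositions: "finite {\<beta>. is_composition \<beta> \<and> sum_list \<beta> \<le> N}"
proof (rule finite_subset)
  show "{\<beta>. is_composition \<beta> \<and> sum_list \<beta> \<le> N} \<subseteq> {\<beta>. set \<beta> \<subseteq> {..N} \<and> length \<beta> \<le> N}"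
    using length_le_sum_list member_le_sum_list by (fastforce intro: order_trans)
qed (rule finite_lists_length_le, simp)

lemma QSym_mult:
  assumes "F \<in> QSym" "G \<in> QSym"
  shows "F * G \<in> QSym"
  unfolding QSym_iff
proof
  show "quasisymmetric (F * G)"
    unfolding quasisymmetric_def
    using assms by (simp add: coeff_mult_conv wcoeff_mult conv_nonzeros wcoeff_nonzeros)
  obtain N where N: "\<And>\<alpha>. wcoeff F \<alpha> \<noteq> 0 \<Longrightarrow> sum_list \<alpha> \<le> N"
    using QSym_bounded_degree[OF assms(1)] by blast
  obtain N' where N': "\<And>\<alpha>. wcoeff G \<alpha> \<noteq> 0 \<Longrightarrow> sum_list \<alpha> \<le> N'"
    using QSym_bounded_degree[OF assms(2)] by blast
  have "support (F * G) \<subseteq> {\<beta>. is_composition \<beta> \<and> sum_list \<beta> \<le> N + N'}"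
  proof
    fix \<beta> assume "\<beta> \<in> support (F * G)"
    hence \<beta>: "is_composition \<beta>" "conv (wcoeff F) (wcoeff G) \<beta> \<noteq> 0"
      using assms by (auto simp: support_def wcoeff_mult)
    from conv_nonzero_splits[OF \<beta>(2)] N N' \<beta>(1)
    show "\<beta> \<in> {\<beta>. is_composition \<beta> \<and> sum_list \<beta> \<le> N + N'}" by (fastforce intro: add_mono)
  qed
  thus "finite (support (F * G))" using finite_compositions finite_subset by blast
qed

lemma euler_Cons: "euler f \<Longrightarrow> euler (\<lambda>\<delta>. f (a # \<delta>))"
proof -
  assume f: "euler f"
  show ?thesis
    unfolding euler_def
  proof (intro allI impI)
    fix \<alpha> \<gamma> :: "nat list" and k :: nat assume "0 < k"
    thus "(\<Sum>j\<le>k. (-1) ^ j * f (a # \<alpha> @ j # (k - j) # \<gamma>)) = 0"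
      using f[unfolded euler_def, rule_format, of k "a # \<alpha>" \<gamma>] by simp
  qed
qed

text \<open>
  Substitution of variables is multiplicative: after $-t$ and $t$ are substituted for two
  consecutive variables, the coefficient of $t^k$ of a product is the sum over $u$ of the
  coefficient of $t^u$ of the first factor times that of $t^{k-u}$ of the second one. As $k > 0$,
  one of $u$ and $k - u$ is positive, and that
  factor is 0.
\<close>

lemma euler_conv_pair:
  assumes "euler f" "euler g" "0 < k"
  shows "(\<Sum>j\<le>k. (-1) ^ j * conv f g (j # (k - j) # \<gamma>)) = 0"
proof -
  define \<Phi> where "\<Phi> = (\<lambda>p q r s. conv (\<lambda>\<delta>. f (p # q # \<delta>)) (\<lambda>\<delta>. g (r # s # \<delta>)) \<gamma>)"
  have "(\<Sum>j\<le>k. (-1) ^ j * conv f g (j # (k - j) # \<gamma>)) =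
    (\<Sum>j\<le>k. \<Sum>p\<le>j. \<Sum>q\<le>k - j. (-1) ^ j * \<Phi> p q (j - p) (k - j - q))"
    by (simp add: \<Phi>_def sum_distrib_left)
  also have "\<dots> = (\<Sum>(j, p, q)\<in>(SIGMA j:{..k}. {..j} \<times> {..k - j}). (-1) ^ j * \<Phi> p q (j - p) (k - j -
      q))"
    by (simp add: sum.Sigma sum.cartesian_product)
  also have "\<dots> = (\<Sum>(u, p, r)\<in>(SIGMA u:{..k}. {..u} \<times> {..k - u}). (-1) ^ (p + r) * \<Phi> p (u - p) r (k
      - u - r))"
    by (rule sum.reindex_bij_witness[of _ "\<lambda>(u, p, r). (p + r, p, u - p)" "\<lambda>(j, p, q). (p + q, p,
        j - p)"])
       (auto simp: diff_diff_left add.commute)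
  also have "\<dots> = (\<Sum>u\<le>k. \<Sum>p\<le>u. \<Sum>r\<le>k - u. (-1) ^ p * (-1) ^ r * \<Phi> p (u - p) r (k - u - r))"
    by (simp add: sum.Sigma sum.cartesian_product power_add)
  also have "\<dots> = (\<Sum>u\<le>k. conv (\<lambda>\<delta>. \<Sum>p\<le>u. (-1) ^ p * f (p # (u - p) # \<delta>))
      (\<lambda>\<delta>. \<Sum>r\<le>k - u. (-1) ^ r * g (r # (k - u - r) # \<delta>)) \<gamma>)"
    by (simp add: conv_lincomb \<Phi>_def)
  also have "\<dots> = 0"
  proof (rule sum.neutral, rule ballI)
    fix u assume "u \<in> {..k}"
    have zero: "(\<lambda>\<delta>. \<Sum>p\<le>v. (-1) ^ p * h (p # (v - p) # \<delta>)) = (\<lambda>_. 0)" if "euler h" "0 < v" for h v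
    proof
      fix \<delta>
      show "(\<Sum>p\<le>v. (-1) ^ p * h (p # (v - p) # \<delta>)) = 0"
        using that(1)[unfolded euler_def, rule_format, OF that(2), of "[]" \<delta>] by simp
    qed
    show "conv (\<lambda>\<delta>. \<Sum>p\<le>u. (-1) ^ p * f (p # (u - p) # \<delta>))
      (\<lambda>\<delta>. \<Sum>r\<le>k - u. (-1) ^ r * g (r # (k - u - r) # \<delta>)) \<gamma> = 0"
    proof (cases "u = 0")
      case True
      thus ?thesis using zero[OF assms(2), of k] assms(3) by (simp add: conv_zero)
    next
      case False
      thus ?thesis using zero[OF assms(1), of u] by (simp add: conv_zero)
    qed
  qed
  finally show ?thesis .
qed

lemma euler_conv:
  assumes "euler f" "euler g"
  shows "euler (conv f g)"
proof -
  have "(\<Sum>j\<le>k. (-1) ^ j * conv f g (\<alpha> @ j # (k - j) # \<gamma>)) = 0" if "0 < k" for \<alpha> \<gamma> k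
    using assms
  proof (induction \<alpha> arbitrary: f g)
    case Nil
    thus ?case using euler_conv_pair that by simp
  next
    case (Cons a \<alpha>)
    have "(\<Sum>j\<le>k. (-1) ^ j * conv f g ((a # \<alpha>) @ j # (k - j) # \<gamma>)) =
      (\<Sum>i\<le>a. \<Sum>j\<le>k. (-1) ^ j * conv (\<lambda>\<delta>. f (i # \<delta>)) (\<lambda>\<delta>. g ((a - i) # \<delta>)) (\<alpha> @ j # (k - j) # \<gamma>))"
      by (simp add: sum_distrib_left) (rule sum.swap)
    also have "\<dots> = 0"
      by (intro sum.neutral ballI Cons.IH euler_Cons Cons.prems)
    finally show ?case .
  qed
  thus ?thesis by (simp add: euler_def)
qed

section \<open>Commutation of $\vartheta$ with the two operators\<close>

lemma scale_mult: "scale c F * G = scale c (F * G)" "F * scale c G = scale c (F * G)"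
  by (rule series_eqI; simp add: coeff_mult sum_distrib_left case_prod_unfold mult.assoc
      mult.left_commute)+

lemma \<Theta>\<^sub>1_eq: "\<Theta>\<^sub>1 = scale 2 (M [1])"
  by (simp add: \<Theta>\<^sub>1_def MS_def composition_of_def)

lemma \<Theta>\<^sub>1_in_QSym: "\<Theta>\<^sub>1 \<in> QSym"
  unfolding \<Theta>\<^sub>1_eq
  by (intro qs.subspace_scale[OF subspace_QSym] M_in_QSym) (simp add: is_composition_def)

lemma wcoeff_\<Theta>\<^sub>1: "wcoeff \<Theta>\<^sub>1 \<alpha> = 2 * of_bool (nonzeros \<alpha> = [1])"
  by (simp add: \<Theta>\<^sub>1_eq wcoeff_M is_composition_def)

lemma conv_unit: "conv (\<lambda>\<alpha>. of_bool (nonzeros \<alpha> = [])) g \<beta> = g \<beta>"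
proof (induction \<beta> arbitrary: g)
  case (Cons b \<beta>)
  have "conv (\<lambda>\<delta>. of_bool (nonzeros (i # \<delta>) = [])) (\<lambda>\<delta>. g ((b - i) # \<delta>)) \<beta> =
    (if i = 0 then g (b # \<beta>) else 0)" for i
    using Cons.IH[of "\<lambda>\<delta>. g (b # \<delta>)"] by (simp add: conv_zero)
  thus ?case by simp
qed simp

lemma conv_variable:
  assumes "is_composition \<beta>" "\<And>\<alpha>. g (nonzeros \<alpha>) = g \<alpha>"
  shows "conv (\<lambda>\<alpha>. of_bool (nonzeros \<alpha> = [1])) g \<beta> = lower_one g \<beta>"
  using assms
proof (induction \<beta> arbitrary: g)
  case (Cons b \<beta>)
  hence b: "0 < b" "is_composition \<beta>" by (auto simp: is_composition_def)
  have tail: "g (b # nonzeros \<alpha>) = g (b # \<alpha>)" for \<alpha>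
    using Cons.prems(2)[of "b # nonzeros \<alpha>"] Cons.prems(2)[of "b # \<alpha>"] by (simp split: if_splits)
  have "conv (\<lambda>\<delta>. of_bool (nonzeros (i # \<delta>) = [1])) (\<lambda>\<delta>. g ((b - i) # \<delta>)) \<beta> =
    (if i = 0 then lower_one (\<lambda>\<delta>. g (b # \<delta>)) \<beta> else if i = 1 then g ((b - 1) # \<beta>) else 0)" for i
    using Cons.IH[OF b(2), of "\<lambda>\<delta>. g (b # \<delta>)"] tail conv_unit[of "\<lambda>\<delta>. g ((b - 1) # \<delta>)" \<beta>]
    by (simp add: conv_zero)
  hence "conv (\<lambda>\<alpha>. of_bool (nonzeros \<alpha> = [1])) g (b # \<beta>) =
    (\<Sum>i\<in>{..b}. if i = 0 then lower_one (\<lambda>\<delta>. g (b # \<delta>)) \<beta> else if i = 1 then g ((b - 1) # \<beta>) else 0)"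
    unfolding conv.simps by (intro sum.cong refl)
  also have "\<dots> = (\<Sum>i\<in>{0, 1 :: nat}. if i = 0 then lower_one (\<lambda>\<delta>. g (b # \<delta>)) \<beta> else if i = 1 then g
      ((b - 1) # \<beta>) else 0)"
    using b by (intro sum.mono_neutral_right) auto
  also have "\<dots> = lower_one (\<lambda>\<delta>. g (b # \<delta>)) \<beta> + g ((b - 1) # \<beta>)" by simp
  also have "g ((b - 1) # \<beta>) = front (b - 1) g \<beta>"
    using Cons.prems(2)[of "0 # \<beta>"] Cons.prems(2)[of \<beta>] by (simp add: front_def)
  finally show ?case by simp
qed simp

lemma wcoeff_\<Theta>\<^sub>1_mult:
  assumes "F \<in> QSym" "is_composition \<beta>"
  shows "wcoeff (\<Theta>\<^sub>1 * F) \<beta> = 2 * lower_one (wcoeff F) \<beta>"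
proof -
  have "wcoeff (\<Theta>\<^sub>1 * F) \<beta> = conv (\<lambda>\<alpha>. 2 * of_bool (nonzeros \<alpha> = [1]) + 0) (wcoeff F) \<beta>"
    unfolding wcoeff_mult[OF \<Theta>\<^sub>1_in_QSym assms(1)] by (intro conv_cong) (simp_all add: wcoeff_\<Theta>\<^sub>1)
  also have "\<dots> = 2 * lower_one (wcoeff F) \<beta>"
    unfolding conv_linear_left conv_variable[where g = "wcoeff F", OF assms(2) wcoeff_nonzeros[OF
        assms(1)]]
    by (simp add: conv_zero)
  finally show ?thesis .
qed

theorem \<theta>_\<Theta>\<^sub>1_mult:
  assumes "F \<in> QSym"
  shows "\<theta> (\<Theta>\<^sub>1 * F) = scale 2 (\<Theta>\<^sub>1 * \<theta> F)"
proof (rule quasisymmetric_eqI)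
  have Q: "\<Theta>\<^sub>1 * F \<in> QSym" using QSym_mult[OF \<Theta>\<^sub>1_in_QSym assms] .
  show "quasisymmetric (\<theta> (\<Theta>\<^sub>1 * F))" using QSym_quasisymmetric(1) \<theta>_in_QSym[OF Q] .
  show "quasisymmetric (scale 2 (\<Theta>\<^sub>1 * \<theta> F))"
    by (intro QSym_quasisymmetric(1) qs.subspace_scale[OF subspace_QSym] QSym_mult \<Theta>\<^sub>1_in_QSym
        \<theta>_in_QSym assms)
  fix \<beta> assume \<beta>: "is_composition \<beta>"
  have "wcoeff (\<theta> (\<Theta>\<^sub>1 * F)) \<beta> = theta_coeff (\<lambda>\<delta>. 2 * lower_one (wcoeff F) \<delta>) \<beta>"
    unfolding wcoeff_\<theta>[OF Q] by (rule theta_coeff_cong) (rule wcoeff_\<Theta>\<^sub>1_mult[OF assms])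
  also have "\<dots> = wcoeff (scale 2 (\<Theta>\<^sub>1 * \<theta> F)) \<beta>"
    using \<beta> by (simp add: theta_coeff_scale theta_coeff_lower_one wcoeff_\<Theta>\<^sub>1_mult \<theta>_in_QSym assms
        wcoeff_\<theta>)
  finally show "wcoeff (\<theta> (\<Theta>\<^sub>1 * F)) \<beta> = wcoeff (scale 2 (\<Theta>\<^sub>1 * \<theta> F)) \<beta>" .
qed

lemma gaps_snoc: "gaps a (ys @ [y]) = gaps a ys @ [y - last (a # ys)]"
  by (induction ys arbitrary: a) auto

lemma L_M:
  assumes "is_composition \<beta>" "\<beta> \<noteq> []"
  shows "L (M \<beta>) = M (butlast \<beta> @ [last \<beta> + 1])"
proof -
  obtain n S where S: "S \<subseteq> {1..n}" and \<beta>: "\<beta> = composition_of n S"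
    using composition_of_surj[OF assms] by blast
  have "finite S" using S by (rule finite_subset) simp
  have "last (0 # sorted_list_of_set S) \<in> insert 0 S"
    using last_in_set[of "0 # sorted_list_of_set S"] \<open>finite S\<close> by auto
  hence "last (0 # sorted_list_of_set S) \<le> n" using S by auto
  hence "composition_of (n + 1) S = butlast \<beta> @ [last \<beta> + 1]"
    by (simp add: \<beta> composition_of_def gaps_snoc del: last.simps)
  thus ?thesis using L_MS[OF S] by (simp add: MS_def \<beta>)
qed

lemma L_L_M:
  assumes "is_composition \<beta>" "\<beta> \<noteq> []"
  shows "L (L (M \<beta>)) = M (butlast \<beta> @ [last \<beta> + 2])"
proof -
  have "is_composition (butlast \<beta> @ [last \<beta> + 1])"
    using assms(1) by (auto simp: is_composition_def dest: in_set_butlastD)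
  thus ?thesis using L_M[OF assms] L_M[of "butlast \<beta> @ [last \<beta> + 1]"] by simp
qed

lemma L_L_expansion:
  assumes "F \<in> QSym" "wcoeff F [] = 0"
  shows "L (L F) = (\<Sum>\<beta>\<in>support F. scale (wcoeff F \<beta>) (M (butlast \<beta> @ [last \<beta> + 2])))"
proof -
  have "L (L F) = L (L (\<Sum>\<beta>\<in>support F. scale (wcoeff F \<beta>) (M \<beta>)))"
    using quasisymmetric_expansion[OF QSym_quasisymmetric[OF assms(1)]] by simp
  also have "\<dots> = (\<Sum>\<beta>\<in>support F. scale (wcoeff F \<beta>) (L (L (M \<beta>))))"
    by (simp add: L_linear)
  also have "\<dots> = (\<Sum>\<beta>\<in>support F. scale (wcoeff F \<beta>) (M (butlast \<beta> @ [last \<beta> + 2])))"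
  proof (intro sum.cong refl)
    fix \<beta> assume "\<beta> \<in> support F"
    hence "is_composition \<beta>" "\<beta> \<noteq> []" using assms(2) by (auto simp: support_def)
    thus "scale (wcoeff F \<beta>) (L (L (M \<beta>))) = scale (wcoeff F \<beta>) (M (butlast \<beta> @ [last \<beta> + 2]))"
      using L_L_M[of \<beta>] by simp
  qed
  finally show ?thesis .
qed

lemma L_L_in_QSym:
  assumes "F \<in> QSym" "wcoeff F [] = 0"
  shows "L (L F) \<in> QSym"
  unfolding L_L_expansion[OF assms]
  by (intro qs.subspace_sum[OF subspace_QSym] qs.subspace_scale[OF subspace_QSym] M_in_QSym)
     (auto simp: support_def is_composition_def dest: in_set_butlastD)

lemma wcoeff_L_L:
  assumes "F \<in> QSym" "wcoeff F [] = 0" "is_composition \<gamma>"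
  shows "wcoeff (L (L F)) \<gamma> = lower_last_two (wcoeff F) \<gamma>"
proof -
  define \<delta> where "\<delta> = butlast \<gamma> @ [last \<gamma> - 2]"
  have "wcoeff (M (butlast \<beta> @ [last \<beta> + 2])) \<gamma> = of_bool (\<gamma> \<noteq> [] \<and> 3 \<le> last \<gamma> \<and> \<beta> = \<delta>)"
    if "\<beta> \<in> support F" for \<beta>
  proof -
    have \<beta>: "is_composition \<beta>" "\<beta> \<noteq> []" using that assms(2) by (auto simp: support_def)
    hence "0 < last \<beta>" by (simp add: is_composition_def)
    have "is_composition (butlast \<beta> @ [last \<beta> + 2])"
      using \<beta>(1) by (auto simp: is_composition_def dest: in_set_butlastD)
    moreover have "\<gamma> = butlast \<beta> @ [last \<beta> + 2] \<longleftrightarrow> \<gamma> \<noteq> [] \<and> 3 \<le> last \<gamma> \<and> \<beta> = \<delta>"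
    proof
      assume "\<gamma> = butlast \<beta> @ [last \<beta> + 2]"
      thus "\<gamma> \<noteq> [] \<and> 3 \<le> last \<gamma> \<and> \<beta> = \<delta>" using \<beta>(2) \<open>0 < last \<beta>\<close> by (simp add: \<delta>_def)
    next
      assume *: "\<gamma> \<noteq> [] \<and> 3 \<le> last \<gamma> \<and> \<beta> = \<delta>"
      hence "last \<gamma> - 2 + 2 = last \<gamma>" by arith
      hence "\<gamma> = butlast \<gamma> @ [last \<gamma> - 2 + 2]" using * by (metis append_butlast_last_id)
      also have "\<dots> = butlast \<beta> @ [last \<beta> + 2]"
        using * by (simp only: \<delta>_def butlast_snoc last_snoc)
      finally show "\<gamma> = butlast \<beta> @ [last \<beta> + 2]" .
    qed
    ultimately show ?thesis by (simp add: wcoeff_M nonzeros_id[OF assms(3)])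
  qed
  hence "wcoeff (L (L F)) \<gamma> = (\<Sum>\<beta>\<in>support F. if \<beta> = \<delta> then (if \<gamma> \<noteq> [] \<and> 3 \<le> last \<gamma> then wcoeff F \<delta>
      else 0) else 0)"
    unfolding L_L_expansion[OF assms(1,2)] wcoeff_simps by (intro sum.cong refl) auto
  also have "\<dots> = (if \<delta> \<in> support F then (if \<gamma> \<noteq> [] \<and> 3 \<le> last \<gamma> then wcoeff F \<delta> else 0) else 0)"
    using QSym_quasisymmetric(2)[OF assms(1)] by (rule sum.delta)
  also have "\<dots> = lower_last_two (wcoeff F) \<gamma>"
  proof (cases "\<gamma> \<noteq> [] \<and> 3 \<le> last \<gamma>")
    case True
    hence "is_composition \<delta>"
      using assms(3) by (auto simp: \<delta>_def is_composition_def dest: in_set_butlastD)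
    thus ?thesis using True by (auto simp: lower_last_two_def support_def \<delta>_def)
  qed (auto simp: lower_last_two_def)
  finally show ?thesis .
qed

theorem \<theta>_L_L:
  assumes "F \<in> QSym" "wcoeff F [] = 0"
  shows "\<theta> (L (L F)) = L (L (\<theta> F))"
proof (rule quasisymmetric_eqI)
  have Q: "L (L F) \<in> QSym" by (rule L_L_in_QSym[OF assms])
  have \<theta>0: "wcoeff (\<theta> F) [] = 0" using assms by (simp add: wcoeff_\<theta>)
  show "quasisymmetric (\<theta> (L (L F)))" using QSym_quasisymmetric(1) \<theta>_in_QSym[OF Q] .
  show "quasisymmetric (L (L (\<theta> F)))"
    using L_L_in_QSym[OF \<theta>_in_QSym[OF assms(1)] \<theta>0] by (rule QSym_quasisymmetric(1))
  fix \<beta> assume \<beta>: "is_composition \<beta>"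
  have "wcoeff (\<theta> (L (L F))) \<beta> = theta_coeff (lower_last_two (wcoeff F)) \<beta>"
    unfolding wcoeff_\<theta>[OF Q] by (rule theta_coeff_cong) (rule wcoeff_L_L[OF assms])
  also have "\<dots> = wcoeff (L (L (\<theta> F))) \<beta>"
    using \<beta> by (simp add: theta_coeff_lower_last_two wcoeff_L_L \<theta>0 \<theta>_in_QSym assms wcoeff_\<theta>)
  finally show "wcoeff (\<theta> (L (L F))) \<beta> = wcoeff (L (L (\<theta> F))) \<beta>" .
qed

section \<open>Joint injectivity of the two operators\<close>

text \<open>
  The derivation applied inside \<open>\<beta>\<close> yields compositions whose sum is one less than that of \<open>\<beta>\<close>, so
  those contributions vanish.
\<close>

lemma lower_one_append:
  assumes "is_composition \<beta>" "\<And>\<alpha>. is_composition \<alpha> \<Longrightarrow> sum_list \<alpha> + 1 = sum_list \<beta> \<Longrightarrow> f (\<alpha> @ \<gamma>) = 0"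
  shows "lower_one f (\<beta> @ \<gamma>) = lower_one (\<lambda>\<delta>. f (\<beta> @ \<delta>)) \<gamma>"
  using assms
proof (induction \<beta> arbitrary: f)
  case (Cons b \<beta>)
  hence b: "0 < b" "is_composition \<beta>" by (auto simp: is_composition_def)
  have "front (b - 1) f (\<beta> @ \<gamma>) = 0"
  proof (cases "b = 1")
    case True
    thus ?thesis using Cons.prems(2)[of \<beta>] b by simp
  next
    case False
    hence "is_composition ((b - 1) # \<beta>)" using b by (auto simp: is_composition_def)
    thus ?thesis using Cons.prems(2)[of "(b - 1) # \<beta>"] b False by (simp add: front_def)
  qed
  moreover have "lower_one (\<lambda>\<delta>. f (b # \<delta>)) (\<beta> @ \<gamma>) = lower_one (\<lambda>\<delta>. f (b # \<beta> @ \<delta>)) \<gamma>"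
  proof (rule Cons.IH[OF b(2)])
    fix \<alpha> assume "is_composition \<alpha>" "sum_list \<alpha> + 1 = sum_list \<beta>"
    thus "f (b # \<alpha> @ \<gamma>) = 0"
      using Cons.prems(2)[of "b # \<alpha>"] b(1) by (simp add: is_composition_def)
  qed
  ultimately show ?case by simp
qed simp

lemma lower_one_ones: "lower_one f (replicate (Suc r) 1) = of_nat (Suc r) * f (replicate r 1)"
proof (induction r arbitrary: f)
  case (Suc r)
  have "lower_one f (replicate (Suc (Suc r)) 1) = f (replicate (Suc r) 1) + lower_one (\<lambda>\<delta>. f (1 #
      \<delta>)) (replicate (Suc r) 1)"
    by simp
  also have "\<dots> = f (replicate (Suc r) 1) + of_nat (Suc r) * f (replicate (Suc r) 1)"
    unfolding Suc.IH by simp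
  finally show ?case by (simp add: algebra_simps)
qed simp

text \<open>
  The system of equations is triangular with respect to the number \<open>r\<close> of final ones: the equation
  for $\beta 1^{r+1}$ relates the value at $\beta 1^r$, with coefficient \<open>r + 1\<close>, to values at
  compositions $\alpha 1^{r+1}$ of the same size. So the induction goes down in \<open>r\<close>, starting from
  \<open>r = N + 1\<close>, which no composition of \<open>N\<close> reaches.
\<close>

lemma lower_one_injective:
  assumes "\<And>\<beta>. is_composition \<beta> \<Longrightarrow> lower_one f (\<beta> @ [1]) = 0" "is_composition \<beta>"
  shows "f \<beta> = 0"
proof -
  have *: "f (\<beta> @ replicate r 1) = 0" if "is_composition \<beta>" "sum_list \<beta> + r = N" "r \<le> N + 1" for r
      N \<beta>
    using that(3,1,2)
  proof (induction r arbitrary: \<beta> rule: inc_induct)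
    case base
    thus ?case by simp
  next
    case (step r)
    have "lower_one f ((\<beta> @ replicate r 1) @ [1]) = 0"
      using step.prems by (intro assms(1)) (auto simp: is_composition_def)
    hence "lower_one f (\<beta> @ replicate (Suc r) 1) = 0"
      by (simp add: replicate_append_same)
    also have "lower_one f (\<beta> @ replicate (Suc r) 1) = lower_one (\<lambda>\<delta>. f (\<beta> @ \<delta>)) (replicate (Suc
        r) 1)"
      using step.prems by (intro lower_one_append step.IH) auto
    also have "\<dots> = of_nat (Suc r) * f (\<beta> @ replicate r 1)"
      by (rule lower_one_ones)
    finally show ?case by (simp del: of_nat_Suc)
  qed
  show ?thesis using *[of \<beta> 0 "sum_list \<beta>"] assms(2) by simp
qed

lemma QSym_eq_0I:
  "F \<in> QSym \<Longrightarrow> (\<And>\<beta>. is_composition \<beta> \<Longrightarrow> wcoeff F \<beta> = 0) \<Longrightarrow> F = 0"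
  using QSym_quasisymmetric(1) qs.subspace_0[OF subspace_QSym]
  by (intro quasisymmetric_eqI) auto

text \<open>
  Only compositions with last part at least 3 occur in $L^2 G$, so the coefficients at
  compositions ending in 1 involve \<open>F\<close> alone.
\<close>

lemma \<Theta>\<^sub>1_L_L_independent:
  assumes "F \<in> QSym" "G \<in> QSym" "wcoeff G [] = 0" "\<Theta>\<^sub>1 * F + L (L G) = 0"
  shows "F = 0" "G = 0"
proof -
  show F: "F = 0"
  proof (rule QSym_eq_0I[OF assms(1)], rule lower_one_injective)
    fix \<beta> :: "nat list" assume "is_composition \<beta>"
    hence "is_composition (\<beta> @ [1])" by (auto simp: is_composition_def)
    hence "2 * lower_one (wcoeff F) (\<beta> @ [1]) + lower_last_two (wcoeff G) (\<beta> @ [1]) = wcoeff (\<Theta>\<^sub>1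
        * F + L (L G)) (\<beta> @ [1])"
      using assms(1-3) by (simp add: wcoeff_\<Theta>\<^sub>1_mult wcoeff_L_L)
    also have "\<dots> = 0" unfolding assms(4) by simp
    finally show "lower_one (wcoeff F) (\<beta> @ [1]) = 0" by (simp add: lower_last_two_def)
  qed
  show "G = 0"
  proof (rule QSym_eq_0I[OF assms(2)])
    fix \<beta> :: "nat list" assume \<beta>: "is_composition \<beta>"
    show "wcoeff G \<beta> = 0"
    proof (cases "\<beta> = []")
      case False
      hence "0 < last \<beta>" using \<beta> by (simp add: is_composition_def)
      have "is_composition (butlast \<beta> @ [last \<beta> + 2])"
        using \<beta> by (auto simp: is_composition_def dest: in_set_butlastD)
      hence "wcoeff (L (L G)) (butlast \<beta> @ [last \<beta> + 2]) = lower_last_two (wcoeff G) (butlast \<beta> @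
          [last \<beta> + 2])"
        by (rule wcoeff_L_L[OF assms(2,3)])
      also have "\<dots> = wcoeff G \<beta>" using False \<open>0 < last \<beta>\<close> by (simp add: lower_last_two_def)
      finally show ?thesis using assms(4) by (simp add: F)
    qed (simp add: assms(3))
  qed
qed

section \<open>The elements $\Omega_w$\<close>

lemma \<Omega>_simps: "\<Omega> [] = \<Theta>\<^sub>1" "\<Omega> (LC # w) = \<Theta>\<^sub>1 * \<Omega> w" "\<Omega> (LD # w) = L (L (\<Omega> w))"
  by (simp_all add: \<Omega>_def)

lemma word_degree_simps [simp]: "word_degree [] = 0" "word_degree (x # w) = letter_degree x +
    word_degree w"
  by (simp_all add: word_degree_def)

text \<open>
  Homogeneity in terms of the coefficients at weak compositions.
\<close>

definition graded :: "nat \<Rightarrow> series \<Rightarrow> bool"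
  where "graded d F \<longleftrightarrow> (\<forall>\<alpha>. wcoeff F \<alpha> \<noteq> 0 \<longrightarrow> sum_list \<alpha> = d)"

lemma graded_\<Theta>\<^sub>1: "graded 1 \<Theta>\<^sub>1"
proof -
  have "sum_list \<alpha> = 1" if "nonzeros \<alpha> = [1]" for \<alpha>
    using sum_list_nonzeros[of \<alpha>] that by simp
  thus ?thesis by (auto simp: graded_def wcoeff_\<Theta>\<^sub>1)
qed

lemma graded_mult:
  "F \<in> QSym \<Longrightarrow> G \<in> QSym \<Longrightarrow> graded d F \<Longrightarrow> graded e G \<Longrightarrow> graded (d + e) (F * G)"
  unfolding graded_def by (metis conv_nonzero_splits wcoeff_mult)

lemma graded_compositionI:
  assumes "F \<in> QSym" "\<And>\<beta>. is_composition \<beta> \<Longrightarrow> wcoeff F \<beta> \<noteq> 0 \<Longrightarrow> sum_list \<beta> = d"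
  shows "graded d F"
  unfolding graded_def
  using assms(2)[OF nonzeros_composition] wcoeff_nonzeros[OF assms(1)] sum_list_nonzeros by metis

lemma graded_L_L:
  assumes "F \<in> QSym" "wcoeff F [] = 0" "graded d F"
  shows "graded (d + 2) (L (L F))"
proof (rule graded_compositionI[OF L_L_in_QSym[OF assms(1,2)]])
  fix \<beta> assume "is_composition \<beta>" "wcoeff (L (L F)) \<beta> \<noteq> 0"
  hence *: "\<beta> \<noteq> []" "3 \<le> last \<beta>" "wcoeff F (butlast \<beta> @ [last \<beta> - 2]) \<noteq> 0"
    using assms(1,2) by (auto simp: wcoeff_L_L lower_last_two_def split: if_splits)
  hence "sum_list (butlast \<beta> @ [last \<beta> - 2]) = d" using assms(3) by (auto simp: graded_def)
  moreover have "sum_list \<beta> = sum_list (butlast \<beta> @ [last \<beta>])" using *(1) by simp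
  ultimately show "sum_list \<beta> = d + 2" using *(2) by simp
qed

lemma \<Omega>_QSym: "\<Omega> w \<in> QSym \<and> graded (word_degree w + 1) (\<Omega> w) \<and> wcoeff (\<Omega> w) [] = 0"
proof (induction w)
  case Nil
  show ?case using \<Theta>\<^sub>1_in_QSym graded_\<Theta>\<^sub>1 by (simp add: \<Omega>_simps wcoeff_\<Theta>\<^sub>1)
next
  case (Cons x w)
  have gr: "graded (word_degree (x # w) + 1) (\<Omega> (x # w)) \<and> \<Omega> (x # w) \<in> QSym"
  proof (cases x)
    case LC
    thus ?thesis using Cons graded_mult[OF \<Theta>\<^sub>1_in_QSym _ graded_\<Theta>\<^sub>1, of "\<Omega> w"] QSym_mult[OF
        \<Theta>\<^sub>1_in_QSym]
      by (simp add: \<Omega>_simps)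
  next
    case LD
    thus ?thesis using Cons graded_L_L[of "\<Omega> w"] L_L_in_QSym[of "\<Omega> w"]
      by (simp add: \<Omega>_simps)
  qed
  hence "wcoeff (\<Omega> (x # w)) [] = 0" unfolding graded_def by fastforce
  thus ?case using gr by blast
qed

lemmas \<Omega>_in_QSym = \<Omega>_QSym[THEN conjunct1]
lemmas graded_\<Omega> = \<Omega>_QSym[THEN conjunct2, THEN conjunct1]
lemmas wcoeff_\<Omega>_Nil = \<Omega>_QSym[THEN conjunct2, THEN conjunct2]

lemma \<theta>_\<Omega>: "\<theta> (\<Omega> w) = scale (2 ^ (count_list w LC + 1)) (\<Omega> w)"
proof (induction w)
  case Nil
  have FS: "FS 0 {} = MS 0 {}" by (simp add: FS_def)
  have "\<Theta> 0 {} = scale 2 (MS 0 {})" by (simp add: \<Theta>_def)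
  thus ?case using \<theta>_FS[of "{}" 0] unfolding FS by (simp add: \<Omega>_simps \<Theta>\<^sub>1_def \<theta>_linear \<Lambda>_def)
next
  case (Cons x w)
  show ?case
  proof (cases x)
    case LC
    thus ?thesis using \<theta>_\<Theta>\<^sub>1_mult[OF \<Omega>_in_QSym, of w] Cons by (simp add: \<Omega>_simps scale_mult)
  next
    case LD
    thus ?thesis using \<theta>_L_L[OF \<Omega>_in_QSym wcoeff_\<Omega>_Nil, of w] Cons by (simp add: \<Omega>_simps L_linear)
  qed
qed

lemma finite_words: "finite {w :: letter list. length w < N}"
proof -
  have "(UNIV :: letter set) = {LC, LD}" by (auto intro: letter.exhaust)
  hence "finite (UNIV :: letter set)" by (metis finite.emptyI finite_insert)
  from finite_lists_length_le[OF this, of N] show ?thesis by (rule rev_finite_subset) auto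
qed

text \<open>
  Sorting the words by their first letter writes the combination as $\Theta_{\bf 1} F + L^2 G$,
  where $F = a_\emptyset + \sum_w a_{{\bf c} w} \Omega_w$ and $G = \sum_w a_{{\bf d} w} \Omega_w$.
  Both vanish, and the constant coefficient of \<open>F\<close> is $a_\emptyset$; the rest is the induction
  hypothesis for shorter words.
\<close>

lemma \<Omega>_combination_eq_0:
  "(\<Sum>w | length w < N. scale (a w) (\<Omega> w)) = 0 \<Longrightarrow> length w < N \<Longrightarrow> a w = 0"
proof (induction N arbitrary: a w)
  case (Suc N)
  let ?W = "{w :: letter list. length w < N}"
  define A where "A = (\<Sum>w\<in>?W. scale (a (LC # w)) (\<Omega> w))"
  define B where "B = (\<Sum>w\<in>?W. scale (a (LD # w)) (\<Omega> w))"
  have W: "{w. length w < Suc N} = insert [] ((#) LC ` ?W \<union> (#) LD ` ?W)"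
  proof (intro set_eqI iffI)
    fix w assume w: "w \<in> {w :: letter list. length w < Suc N}"
    show "w \<in> insert [] ((#) LC ` ?W \<union> (#) LD ` ?W)"
    proof (cases w)
      case (Cons x v)
      thus ?thesis using w by (cases x) auto
    qed simp
  qed auto
  have QA: "A \<in> QSym" and QB: "B \<in> QSym"
    unfolding A_def B_def
    by (intro qs.subspace_sum[OF subspace_QSym] qs.subspace_scale[OF subspace_QSym] \<Omega>_in_QSym)+
  have A0: "wcoeff A [] = 0" and B0: "wcoeff B [] = 0"
    by (simp_all add: A_def B_def wcoeff_\<Omega>_Nil)
  define F where "F = scale (a []) 1 + A"
  have QF: "F \<in> QSym"
    unfolding F_def by (intro qs.subspace_add[OF subspace_QSym] qs.subspace_scale[OF
        subspace_QSym] one_in_QSym QA)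
  have "0 = (\<Sum>w | length w < Suc N. scale (a w) (\<Omega> w))" using Suc.prems(1) by simp
  also have "\<dots> = scale (a []) \<Theta>\<^sub>1 + ((\<Sum>w\<in>?W. scale (a (LC # w)) (\<Theta>\<^sub>1 * \<Omega> w)) + (\<Sum>w\<in>?W. scale (a
      (LD # w)) (L (L (\<Omega> w)))))"
  proof -
    have "finite ((#) LC ` ?W)" "finite ((#) LD ` ?W)" "(#) LC ` ?W \<inter> (#) LD ` ?W = {}"
      "[] \<notin> (#) LC ` ?W \<union> (#) LD ` ?W"
      by (auto simp: finite_words)
    moreover have "(\<Sum>w\<in>(#) x ` ?W. scale (a w) (\<Omega> w)) = (\<Sum>w\<in>?W. scale (a (x # w)) (\<Omega> (x # w)))"
        for x
      by (subst sum.reindex) auto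
    ultimately show ?thesis
      unfolding W by (simp add: sum.union_disjoint \<Omega>_simps del: Un_iff)
  qed
  also have "\<dots> = \<Theta>\<^sub>1 * F + L (L B)"
    by (simp add: F_def A_def B_def distrib_left scale_mult sum_distrib_left L_linear add.assoc)
  finally have FB: "F = 0" "B = 0"
    using \<Theta>\<^sub>1_L_L_independent[OF QF QB B0] by simp_all
  have "wcoeff F [] = a []" by (simp add: F_def A0 wcoeff_one)
  hence a0: "a [] = 0" using FB(1) by simp
  hence "A = 0" using FB(1) by (simp add: F_def)
  hence C: "a (LC # v) = 0" if "length v < N" for v
    using Suc.IH[of "\<lambda>w. a (LC # w)" v] that by (simp add: A_def)
  have D: "a (LD # v) = 0" if "length v < N" for v
    using Suc.IH[of "\<lambda>w. a (LD # w)" v] that FB(2) by (simp add: B_def)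
  show ?case
  proof (cases w)
    case (Cons x v)
    thus ?thesis using Suc.prems(2) C D by (cases x) auto
  qed (simp add: a0)
qed simp

lemma \<Omega>_finite_combination_eq_0:
  assumes "finite W" "(\<Sum>w\<in>W. scale (a w) (\<Omega> w)) = 0" "w \<in> W"
  shows "a w = 0"
proof -
  define N where "N = Suc (Max (length ` W))"
  have W: "W \<subseteq> {w. length w < N}" using assms(1) by (auto simp: N_def less_Suc_eq_le)
  have "(\<Sum>w | length w < N. scale (if w \<in> W then a w else 0) (\<Omega> w)) = (\<Sum>w\<in>W. scale (a w) (\<Omega> w))"
    using W by (intro sum.mono_neutral_cong_right) (auto simp: finite_words)
  thus ?thesis
    using \<Omega>_combination_eq_0[where N = N and a = "\<lambda>w. if w \<in> W then a w else 0" and w = w] assms W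
        by auto
qed

lemma inj_\<Omega>: "inj \<Omega>"
proof (rule injI, rule ccontr)
  fix v w assume vw: "\<Omega> v = \<Omega> w" "v \<noteq> w"
  have "(\<Sum>u\<in>{v, w}. scale (if u = v then 1 else -1) (\<Omega> u)) = 0"
    using vw by (simp flip: qs.scale_left_distrib)
  from \<Omega>_finite_combination_eq_0[OF _ this, of v] show False by simp
qed

lemma independent_\<Omega>: "qs.independent (range \<Omega>)"
  unfolding qs.independent_explicit_module
proof (intro allI impI)
  fix t u v
  assume t: "finite t" "t \<subseteq> range \<Omega>" and 0: "(\<Sum>v\<in>t. scale (u v) v) = 0" and v: "v \<in> t"
  define W where "W = \<Omega> -` t"
  have "finite W" unfolding W_def using t(1) inj_\<Omega> by (rule finite_vimageI)
  have tW: "t = \<Omega> ` W" using t(2) by (auto simp: W_def)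
  have "(\<Sum>w\<in>W. scale (u (\<Omega> w)) (\<Omega> w)) = 0"
    using 0 unfolding tW by (subst (asm) sum.reindex) (auto intro: inj_on_subset[OF inj_\<Omega>])
  moreover obtain w where "w \<in> W" "v = \<Omega> w" using v tW by blast
  ultimately show "u v = 0" using \<Omega>_finite_combination_eq_0[OF \<open>finite W\<close>, of "\<lambda>w. u (\<Omega> w)" w] by
      simp
qed

lemma \<Omega>_nonzero: "\<Omega> w \<noteq> 0"
  using independent_\<Omega> qs.dependent_zero by (metis rangeI)

section \<open>The peak algebra\<close>

lemma subalgebra_Peak: "subalgebra Peak"
  unfolding Peak_def
  by (rule hull_in) (auto simp: subalgebra_def intro: qs.subspace_Inter)

lemma subspace_Peak: "qs.subspace Peak" and one_in_Peak: "1 \<in> Peak"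
  using subalgebra_Peak by (auto simp: subalgebra_def)

lemma \<Theta>_in_Peak: "left_sparse n S \<Longrightarrow> \<Theta> n S \<in> Peak"
  unfolding Peak_def by (rule hull_inc) auto

lemma left_sparse_\<Lambda>: "S \<subseteq> {1..n} \<Longrightarrow> left_sparse n (\<Lambda> S)"
  by (auto simp: left_sparse_def \<Lambda>_def)

lemma \<Lambda>_left_sparse: "left_sparse n S \<Longrightarrow> \<Lambda> S = S"
  by (auto simp: left_sparse_def \<Lambda>_def)

text \<open>
  $\Lambda(S)$ is left sparse.
\<close>

lemma \<theta>_QSym_in_Peak: "F \<in> QSym \<Longrightarrow> \<theta> F \<in> Peak"
  unfolding QSym_span_FS
proof (induction rule: qs.span_induct_alt)
  case base
  show ?case by (simp add: \<theta>_linear qs.subspace_0[OF subspace_Peak])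
next
  case (step c x y)
  have "\<theta> x \<in> Peak"
    using step(1) by (auto simp: \<theta>_one one_in_Peak \<theta>_FS \<Theta>_in_Peak left_sparse_\<Lambda>)
  thus ?case using step(2) unfolding \<theta>_linear
    by (intro qs.subspace_add[OF subspace_Peak] qs.subspace_scale[OF subspace_Peak])
qed

definition Euler :: "series set"
  where "Euler = {F \<in> QSym. euler (wcoeff F)}"

lemma eulerD: "euler f \<Longrightarrow> 0 < k \<Longrightarrow> (\<Sum>j\<le>k. (-1) ^ j * f (\<alpha> @ j # (k - j) # \<gamma>)) = 0"
  by (simp add: euler_def)

lemma subspace_Euler: "qs.subspace Euler"
proof (rule qs.subspaceI)
  show "0 \<in> Euler" by (simp add: Euler_def euler_def qs.subspace_0[OF subspace_QSym])
next
  fix F G assume "F \<in> Euler" "G \<in> Euler"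
  thus "F + G \<in> Euler"
    by (auto simp: Euler_def euler_def distrib_left sum.distrib qs.subspace_add[OF subspace_QSym])
next
  fix c F assume F: "F \<in> Euler"
  have "(\<Sum>j\<le>k. (-1) ^ j * (c * wcoeff F (\<alpha> @ j # (k - j) # \<gamma>))) =
      c * (\<Sum>j\<le>k. (-1) ^ j * wcoeff F (\<alpha> @ j # (k - j) # \<gamma>))" for \<alpha> \<gamma> k
    by (simp add: sum_distrib_left mult.left_commute)
  thus "scale c F \<in> Euler"
    using F by (auto simp: Euler_def euler_def qs.subspace_scale[OF subspace_QSym])
qed

lemma subalgebra_Euler: "subalgebra Euler"
  unfolding subalgebra_def
proof (intro conjI ballI subspace_Euler)
  have "(\<Sum>j\<le>k. (-1) ^ j * wcoeff 1 (\<alpha> @ j # (k - j) # \<gamma>)) = 0" if "0 < k" for \<alpha> \<gamma> k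
    by (rule sum.neutral) (use that in \<open>auto simp: wcoeff_one\<close>)
  thus "1 \<in> Euler" by (simp add: Euler_def euler_def one_in_QSym)
next
  fix F G assume "F \<in> Euler" "G \<in> Euler"
  moreover from this have "wcoeff (F * G) = conv (wcoeff F) (wcoeff G)"
    by (auto simp: Euler_def wcoeff_mult)
  ultimately show "F * G \<in> Euler" by (auto simp: Euler_def euler_conv QSym_mult)
qed

text \<open>
  The generators $\Theta_S$ are images under $\vartheta$, since $\Lambda(S) = S$ for left sparse
  $S$, and the Euler relations define a subalgebra.
\<close>

lemma Peak_subset_Euler: "Peak \<subseteq> Euler"
  unfolding Peak_def
proof (rule hull_minimal, clarify)
  fix n S assume S: "left_sparse n S"
  hence "\<Theta> n S = \<theta> (FS n S)"
    using \<theta>_FS[of S n] \<Lambda>_left_sparse[OF S] unfolding left_sparse_def by metis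
  thus "\<Theta> n S \<in> Euler"
    using euler_theta_coeff by (simp add: Euler_def FS_in_QSym \<theta>_in_QSym wcoeff_\<theta>)
qed (rule subalgebra_Euler)

text \<open>
  As an eigenvector with nonzero eigenvalue $\Omega_w$ is in the image of $\vartheta$.
\<close>

lemma \<Omega>_in_Peak: "\<Omega> w \<in> Peak"
proof -
  have "\<Omega> w = scale (1 / 2 ^ (count_list w LC + 1)) (\<theta> (\<Omega> w))"
    by (simp add: \<theta>_\<Omega>)
  also have "\<dots> \<in> Peak"
    by (intro qs.subspace_scale[OF subspace_Peak] \<theta>_QSym_in_Peak \<Omega>_in_QSym)
  finally show ?thesis .
qed

section \<open>The dimension of the Euler part in each degree\<close>

text \<open>
  The word ${\bf d}^{a_1} {\bf c}\, {\bf d}^{a_2} {\bf c} \cdots {\bf c}\, {\bf d}^{a_l}$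
  corresponds to $(2 a_1 + 1, \dots, 2 a_l + 1)$.
\<close>

fun odd_composition :: "letter list \<Rightarrow> nat list" where
  "odd_composition [] = [1]"
| "odd_composition (LC # w) = 1 # odd_composition w"
| "odd_composition (LD # w) = (hd (odd_composition w) + 2) # tl (odd_composition w)"

lemma is_composition_odd_composition: "is_composition (odd_composition w)"
proof -
  have "odd_composition w \<noteq> [] \<and> is_composition (odd_composition w)"
  proof (induction w)
    case (Cons x w)
    thus ?case by (cases x; cases "odd_composition w") (auto simp: is_composition_def)
  qed (simp add: is_composition_def)
  thus ?thesis by simp
qed

lemma odd_composition_surj:
  "\<forall>b\<in>set \<beta>. odd b \<Longrightarrow> sum_list \<beta> = n + 1 \<Longrightarrow> \<exists>w. word_degree w = n \<and> odd_composition w = \<beta>"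
proof (induction n arbitrary: \<beta> rule: less_induct)
  case (less n)
  then obtain b \<delta> where \<beta>: "\<beta> = b # \<delta>" by (cases \<beta>) auto
  have b: "odd b" using less.prems by (simp add: \<beta>)
  show ?case
  proof (cases "b = 1")
    case True
    show ?thesis
    proof (cases "\<delta> = []")
      case True
      thus ?thesis using \<open>b = 1\<close> less.prems by (intro exI[of _ "[]"]) (simp add: \<beta>)
    next
      case False
      then obtain c \<epsilon> where \<delta>: "\<delta> = c # \<epsilon>" by (cases \<delta>) auto
      have "odd c" using less.prems by (simp add: \<beta> \<delta>)
      hence "0 < c" by (rule odd_pos)
      hence n: "sum_list \<delta> = (n - 1) + 1" "0 < n" using less.prems True by (simp_all add: \<beta> \<delta>)
      obtain w where "word_degree w = n - 1" "odd_composition w = \<delta>"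
        using less.IH[of "n - 1" \<delta>] less.prems n by (auto simp: \<beta>)
      thus ?thesis using True n by (intro exI[of _ "LC # w"]) (simp add: \<beta>)
    qed
  next
    case False
    hence b3: "3 \<le> b" using b by (metis One_nat_def Suc_1 even_Suc le_antisym not_less_eq_eq
        numeral_3_eq_3 odd_pos Suc_leI)
    have "\<exists>w. word_degree w = n - 2 \<and> odd_composition w = (b - 2) # \<delta>"
      using less.prems b3 by (intro less.IH) (auto simp: \<beta>)
    then obtain w where "word_degree w = n - 2" "odd_composition w = (b - 2) # \<delta>" by blast
    moreover have "b - 2 + 2 = b" "n - 2 + 2 = n" using b3 less.prems(2) by (simp_all add: \<beta>)
    ultimately show ?thesis by (intro exI[of _ "LD # w"]) (simp add: \<beta>)
  qed
qed

text \<open>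
  If \<open>\<beta>\<close> has an even part \<open>k\<close>, then the Euler relation that splits \<open>k\<close> has the coefficient at \<open>\<beta>\<close>
  as its two extreme summands, with the same sign; all other summands belong to longer
  compositions.
\<close>

lemma euler_determined_by_odd:
  assumes "euler f" "\<And>\<alpha>. f (nonzeros \<alpha>) = f \<alpha>"
    and odd: "\<And>\<beta>. \<forall>b\<in>set \<beta>. odd b \<Longrightarrow> sum_list \<beta> = N \<Longrightarrow> f \<beta> = 0"
    and "is_composition \<beta>" "sum_list \<beta> = N"
  shows "f \<beta> = 0"
  using assms(4,5)
proof (induction "N - length \<beta>" arbitrary: \<beta> rule: less_induct)
  case less
  show ?case
  proof (cases "\<forall>b\<in>set \<beta>. odd b")
    case False
    then obtain k where "k \<in> set \<beta>" "even k" by blast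
    then obtain \<alpha> \<gamma> where \<beta>: "\<beta> = \<alpha> @ k # \<gamma>" by (meson split_list)
    have k: "0 < k" using less.prems(1) by (simp add: \<beta> is_composition_def)
    have ends: "f (\<alpha> @ 0 # k # \<gamma>) = f \<beta>" "f (\<alpha> @ k # 0 # \<gamma>) = f \<beta>"
      using assms(2)[of "\<alpha> @ 0 # k # \<gamma>"] assms(2)[of "\<alpha> @ k # 0 # \<gamma>"] assms(2)[of \<beta>] k by
          (simp_all add: \<beta>)
    have mid: "f (\<alpha> @ j # (k - j) # \<gamma>) = 0" if j: "0 < j" "j < k" for j
    proof (rule less.hyps)
      let ?\<beta> = "\<alpha> @ j # (k - j) # \<gamma>"
      show c: "is_composition ?\<beta>" using less.prems(1) j by (simp add: \<beta> is_composition_def)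
      show s: "sum_list ?\<beta> = N" using less.prems(2) j by (simp add: \<beta>)
      show "N - length ?\<beta> < N - length \<beta>"
        using length_le_sum_list[OF c] s by (simp add: \<beta>)
    qed
    have "0 = (\<Sum>j\<le>k. (-1) ^ j * f (\<alpha> @ j # (k - j) # \<gamma>))"
      using eulerD[OF assms(1) k] by simp
    also have "\<dots> = (\<Sum>j\<in>{0, k}. (-1) ^ j * f (\<alpha> @ j # (k - j) # \<gamma>))"
      by (rule sum.mono_neutral_right) (use mid in auto)
    also have "\<dots> = 2 * f \<beta>" using k \<open>even k\<close> ends by simp
    finally show ?thesis by simp
  qed (use odd less.prems in blast)
qed

lemma finite_words_degree: "finite {w. word_degree w = n}"
proof (rule finite_subset)
  have "length w \<le> word_degree w" for w
  proof (induction w)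
    case (Cons x w)
    thus ?case by (cases x) auto
  qed simp
  thus "{w. word_degree w = n} \<subseteq> {w. length w < Suc n}" by (auto simp: less_Suc_eq_le)
qed (rule finite_words)

lemma subspace_graded: "qs.subspace {F. graded d F}"
  by (rule qs.subspaceI) (auto simp: graded_def, metis add.right_neutral)

text \<open>
  Let $\phi$ keep the coefficients at the compositions that come from words of degree \<open>n\<close>. It is
  injective on the Euler part of degree \<open>n + 1\<close>. If \<open>F\<close> were outside the span, then \<open>F\<close> and the
  $\Omega_w$ would have linearly independent images, more than the dimension of the target allows.
\<close>

lemma Euler_graded_spanned:
  assumes "F \<in> Euler" "graded (n + 1) F"
  shows "F \<in> qs.span (\<Omega> ` {w. word_degree w = n})"
proof (rule ccontr)
  assume notin: "F \<notin> qs.span (\<Omega> ` {w. word_degree w = n})"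
  define W where "W = {w. word_degree w = n}"
  define B where "B = odd_composition ` W"
  define \<phi> where "\<phi> = (\<lambda>G. \<Sum>\<beta>\<in>B. scale (wcoeff G \<beta>) (M \<beta>))"
  have finW: "finite W" unfolding W_def by (rule finite_words_degree)
  hence finB: "finite B" by (simp add: B_def)
  have lin: "linear_map \<phi>"
    unfolding Vector_Spaces.linear_iff
    by (simp add: \<phi>_def qs.scale_left_distrib sum.distrib qs.scale_sum_right qs.vector_space_axioms)
  define E where "E = {G \<in> Euler. graded (n + 1) G}"
  have E: "qs.subspace E"
    unfolding E_def Collect_conj_eq Collect_mem_eq by (intro qs.subspace_inter subspace_Euler
        subspace_graded)
  have zero: "G = 0" if "G \<in> E" "\<phi> G = 0" for G
  proof (rule QSym_eq_0I)
    show Q: "G \<in> QSym" using that by (simp add: E_def Euler_def)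
    have odd: "wcoeff G \<beta> = 0" if \<beta>: "\<forall>b\<in>set \<beta>. odd b" "sum_list \<beta> = n + 1" for \<beta>
    proof -
      have "\<beta> \<in> B" using odd_composition_surj[OF \<beta>] by (auto simp: B_def W_def)
      have "0 = wcoeff (\<phi> G) \<beta>" using \<open>\<phi> G = 0\<close> by simp
      also have "\<dots> = (\<Sum>\<gamma>\<in>B. if \<gamma> = \<beta> then wcoeff G \<beta> else 0)"
        unfolding \<phi>_def wcoeff_simps
      proof (intro sum.cong refl)
        fix \<gamma> assume "\<gamma> \<in> B"
        hence "is_composition \<gamma>" "is_composition \<beta>" using is_composition_odd_composition \<open>\<beta> \<in> B\<close>
            by (auto simp: B_def)
        thus "wcoeff G \<gamma> * wcoeff (M \<gamma>) \<beta> = (if \<gamma> = \<beta> then wcoeff G \<beta> else 0)"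
          using nonzeros_id[of \<beta>] by (simp add: wcoeff_M)
      qed
      also have "\<dots> = wcoeff G \<beta>" using finB \<open>\<beta> \<in> B\<close> by simp
      finally show ?thesis by simp
    qed
    fix \<beta> :: "nat list" assume \<beta>: "is_composition \<beta>"
    show "wcoeff G \<beta> = 0"
    proof (cases "sum_list \<beta> = n + 1")
      case True
      show ?thesis
        by (rule euler_determined_by_odd[where f = "wcoeff G", OF _ wcoeff_nonzeros[OF Q] odd \<beta>
            True])
           (use that in \<open>auto simp: E_def Euler_def\<close>)
    next
      case False
      thus ?thesis using that by (auto simp: E_def graded_def)
    qed
  qed
  define C where "C = insert F (\<Omega> ` W)"
  have "\<Omega> ` W \<subseteq> E"
    using Peak_subset_Euler \<Omega>_in_Peak graded_\<Omega> by (auto simp: E_def W_def)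
  hence "qs.span C \<subseteq> E"
    using assms by (intro qs.span_minimal E) (auto simp: C_def E_def)
  hence inj: "inj_on \<phi> (qs.span C)"
    using zero qs.subspace_diff[OF E] qs_pair.linear_diff[OF lin]
    by (intro inj_onI) (metis eq_iff_diff_eq_0 subsetD)
  have "qs.independent (\<Omega> ` W)"
    using independent_\<Omega> by (rule qs.independent_mono) auto
  hence "qs.independent C"
    unfolding C_def using notin by (intro qs.independent_insertI) (auto simp: W_def)
  hence ind: "qs.independent (\<phi> ` C)"
    using inj by (rule qs_pair.linear_independent_injective_image[OF lin])
  have "\<phi> ` C \<subseteq> qs.span (M ` B)"
    unfolding \<phi>_def
    by (intro image_subsetI qs.span_sum qs.span_scale) (auto intro: qs.span_base)
  hence "card (\<phi> ` C) \<le> card (M ` B)"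
    using qs.independent_span_bound[OF _ ind] finB by blast
  also have "\<dots> \<le> card W"
    unfolding B_def image_image by (rule card_image_le[OF finW])
  finally have "card (\<phi> ` C) \<le> card W" .
  moreover have "card (\<phi> ` C) = card C"
    by (rule card_image) (rule inj_on_subset[OF inj qs.span_superset])
  moreover have "card C = Suc (card W)"
  proof -
    have "F \<notin> \<Omega> ` W" using notin qs.span_base by (auto simp: W_def)
    thus ?thesis using finW card_image[OF inj_on_subset[OF inj_\<Omega>, of W]] by (simp add: C_def)
  qed
  ultimately show False by simp
qed

section \<open>Decomposition of the peak algebra by degree\<close>

lemma mdeg_quasi_monom:
  assumes "sorted_wrt (<) is" "length is = length \<beta>" "is_composition \<beta>"
  shows "mdeg (quasi_monom is \<beta>) = sum_list \<beta>"
proof -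
  let ?m = "quasi_monom is \<beta>"
  have "sum_list \<beta> = sum_list (map (Poly_Mapping.lookup ?m) (sorted_list_of_set (Poly_Mapping.keys
      ?m)))"
    using quasi_monom_unique[OF assms] by simp
  also have "\<dots> = mdeg ?m"
    unfolding mdeg_def by (subst sum_list_distinct_conv_sum_set) auto
  finally show ?thesis by simp
qed

lemma homogeneous_iff_graded:
  assumes "F \<in> QSym"
  shows "homogeneous d F \<longleftrightarrow> graded d F"
proof
  assume F: "homogeneous d F"
  show "graded d F"
  proof (rule graded_compositionI[OF assms])
    fix \<beta> assume "is_composition \<beta>" "wcoeff F \<beta> \<noteq> 0"
    thus "sum_list \<beta> = d"
      using F mdeg_quasi_monom[of "[0..<length \<beta>]" \<beta>] by (simp add: homogeneous_def wcoeff_def)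
  qed
next
  assume F: "graded d F"
  show "homogeneous d F"
    unfolding homogeneous_def
  proof (intro allI impI)
    fix m assume m: "coeff F m \<noteq> 0"
    obtain "is" \<beta> where *: "sorted_wrt (<) is" "length is = length \<beta>" "is_composition \<beta>" "m =
        quasi_monom is \<beta>"
      by (rule monomial_eq_quasi_monom)
    hence "coeff F m = wcoeff F \<beta>"
      using QSym_quasisymmetric(1)[OF assms] nonzeros_id[of \<beta>] unfolding quasisymmetric_def by simp
    thus "mdeg m = d" using m F mdeg_quasi_monom[OF *(1-3)] by (simp add: graded_def *(4))
  qed
qed

lemma Peak_subset_QSym: "Peak \<subseteq> QSym"
  using Peak_subset_Euler by (auto simp: Euler_def)

lemma Peak_part_eq: "Peak_part d = {F \<in> Peak. graded d F}"
  using Peak_subset_QSym homogeneous_iff_graded by (auto simp: Peak_part_def QSym_part_def)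

theorem Peak_part_span: "qs.span (\<Omega> ` {w. word_degree w = n}) = Peak_part (n + 1)"
proof
  have "qs.subspace (Peak_part (n + 1))"
    unfolding Peak_part_eq Collect_conj_eq Collect_mem_eq
    by (intro qs.subspace_inter subspace_Peak subspace_graded)
  thus "qs.span (\<Omega> ` {w. word_degree w = n}) \<subseteq> Peak_part (n + 1)"
    using \<Omega>_in_Peak graded_\<Omega> by (intro qs.span_minimal) (auto simp: Peak_part_eq)
  show "Peak_part (n + 1) \<subseteq> qs.span (\<Omega> ` {w. word_degree w = n})"
    using Euler_graded_spanned Peak_subset_Euler by (auto simp: Peak_part_eq)
qed

definition graded_component :: "nat \<Rightarrow> series \<Rightarrow> series"
  where "graded_component d F = (\<Sum>\<beta> | \<beta> \<in> support F \<and> sum_list \<beta> = d. scale (wcoeff F \<beta>) (M \<beta>))"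

lemma wcoeff_graded_component:
  assumes "F \<in> QSym"
  shows "wcoeff (graded_component d F) \<alpha> = (if sum_list \<alpha> = d then wcoeff F \<alpha> else 0)"
proof -
  let ?A = "{\<beta> \<in> support F. sum_list \<beta> = d}"
  have "wcoeff (graded_component d F) \<alpha> = (\<Sum>\<beta>\<in>?A. if \<beta> = nonzeros \<alpha> then wcoeff F \<alpha> else 0)"
    unfolding graded_component_def wcoeff_simps
    using wcoeff_nonzeros[OF assms] by (intro sum.cong refl) (auto simp: support_def wcoeff_M)
  also have "\<dots> = (if nonzeros \<alpha> \<in> ?A then wcoeff F \<alpha> else 0)"
    using QSym_quasisymmetric(2)[OF assms] by simp
  finally show ?thesis
    using wcoeff_nonzeros[OF assms, of \<alpha>] nonzeros_composition[of \<alpha>]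
    by (auto simp: support_def sum_list_nonzeros)
qed

lemma graded_component_in_QSym: "graded_component d F \<in> QSym"
  unfolding graded_component_def
  by (intro qs.subspace_sum[OF subspace_QSym] qs.subspace_scale[OF subspace_QSym] M_in_QSym)
     (simp add: support_def)

text \<open>
  All summands of an Euler relation have the same degree.
\<close>

lemma graded_component_in_Euler:
  assumes "F \<in> Euler"
  shows "graded_component d F \<in> Euler"
proof -
  have Q: "F \<in> QSym" using assms by (simp add: Euler_def)
  have "(\<Sum>j\<le>k. (-1) ^ j * wcoeff (graded_component d F) (\<alpha> @ j # (k - j) # \<gamma>)) = 0" if "0 < k" for
      \<alpha> \<gamma> k
  proof (cases "sum_list \<alpha> + k + sum_list \<gamma> = d")
    case True
    have "(\<Sum>j\<le>k. (-1) ^ j * wcoeff (graded_component d F) (\<alpha> @ j # (k - j) # \<gamma>)) =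
      (\<Sum>j\<le>k. (-1) ^ j * wcoeff F (\<alpha> @ j # (k - j) # \<gamma>))"
      using True by (intro sum.cong refl) (simp add: wcoeff_graded_component[OF Q])
    thus ?thesis using assms eulerD[OF _ that] by (simp add: Euler_def)
  next
    case False
    thus ?thesis by (intro sum.neutral) (auto simp: wcoeff_graded_component[OF Q])
  qed
  thus ?thesis by (simp add: Euler_def euler_def graded_component_in_QSym)
qed

lemma Euler_subset_span: "Euler \<subseteq> qs.span (insert 1 (range \<Omega>))"
proof
  fix F assume F: "F \<in> Euler"
  hence Q: "F \<in> QSym" by (simp add: Euler_def)
  obtain N where N: "\<And>\<alpha>. wcoeff F \<alpha> \<noteq> 0 \<Longrightarrow> sum_list \<alpha> \<le> N"
    using QSym_bounded_degree[OF Q] by blast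
  let ?G = "\<Sum>d\<le>N. graded_component d F"
  have "F = ?G"
  proof (rule quasisymmetric_eqI)
    show "quasisymmetric F" using Q by (rule QSym_quasisymmetric)
    show "quasisymmetric ?G"
      by (intro QSym_quasisymmetric(1) qs.subspace_sum[OF subspace_QSym] graded_component_in_QSym)
    fix \<beta>
    show "wcoeff F \<beta> = wcoeff ?G \<beta>"
      using N[of \<beta>] by (auto simp: wcoeff_graded_component[OF Q])
  qed
  also have "?G \<in> qs.span (insert 1 (range \<Omega>))"
  proof (rule qs.span_sum)
    fix d
    show "graded_component d F \<in> qs.span (insert 1 (range \<Omega>))"
    proof (cases d)
      case 0
      have "graded_component 0 F = scale (wcoeff F []) 1"
      proof (rule quasisymmetric_eqI)
        show "quasisymmetric (graded_component 0 F)"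
          using graded_component_in_QSym by (rule QSym_quasisymmetric)
        show "quasisymmetric (scale (wcoeff F []) 1)"
          by (intro QSym_quasisymmetric(1) qs.subspace_scale[OF subspace_QSym] one_in_QSym)
        fix \<beta> assume \<beta>: "is_composition \<beta>"
        hence "sum_list \<beta> = 0 \<longleftrightarrow> \<beta> = []" by (cases \<beta>) (auto simp: is_composition_def)
        thus "wcoeff (graded_component 0 F) \<beta> = wcoeff (scale (wcoeff F []) 1) \<beta>"
          using nonzeros_id[OF \<beta>] by (auto simp: wcoeff_graded_component[OF Q] wcoeff_one)
      qed
      thus ?thesis using 0 by (simp add: qs.span_scale qs.span_base)
    next
      case (Suc n)
      have "graded (n + 1) (graded_component d F)"
        by (simp add: graded_def wcoeff_graded_component[OF Q] Suc)
      hence "graded_component d F \<in> qs.span (\<Omega> ` {w. word_degree w = n})"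
        by (rule Euler_graded_spanned[OF graded_component_in_Euler[OF F]])
      also have "\<dots> \<subseteq> qs.span (insert 1 (range \<Omega>))" by (rule qs.span_mono) auto
      finally show ?thesis .
    qed
  qed
  finally show "F \<in> qs.span (insert 1 (range \<Omega>))" .
qed

lemma Peak_eq_span: "qs.span (insert 1 (range \<Omega>)) = Peak"
proof
  show "qs.span (insert 1 (range \<Omega>)) \<subseteq> Peak"
    by (rule qs.span_minimal[OF _ subspace_Peak]) (auto simp: one_in_Peak \<Omega>_in_Peak)
qed (use Peak_subset_Euler Euler_subset_span in blast)

lemma independent_one_\<Omega>: "qs.independent (insert 1 (range \<Omega>))"
proof (rule qs.independent_insertI[OF _ independent_\<Omega>])
  have "wcoeff F [] = 0" if "F \<in> qs.span (range \<Omega>)" for F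
    using that
    by (induction rule: qs.span_induct_alt) (auto simp: wcoeff_\<Omega>_Nil)
  thus "1 \<notin> qs.span (range \<Omega>)" using wcoeff_one[of "[]"] by auto
qed

theorem eigenvector_\<Omega>: "eigenvector \<theta> (2 ^ (count_list w LC + 1)) (\<Omega> w)"
  by (simp add: eigenvector_def \<Omega>_nonzero \<theta>_\<Omega>)

theorem diagonalizable_Peak: "diagonalizable_on \<theta> Peak"
  unfolding diagonalizable_on_def
proof (intro conjI exI)
  show "\<theta> ` Peak \<subseteq> Peak" using Peak_subset_QSym \<theta>_QSym_in_Peak by auto
  show "qs.independent (insert 1 (range \<Omega>))" by (rule independent_one_\<Omega>)
  show "qs.span (insert 1 (range \<Omega>)) = Peak" by (rule Peak_eq_span)
  have "eigenvector \<theta> 1 1" by (simp add: eigenvector_def \<theta>_one)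
  thus "\<forall>b\<in>insert 1 (range \<Omega>). \<exists>c. eigenvector \<theta> c b" using eigenvector_\<Omega> by auto
qed

section \<open>Eigenvalues\<close>

lemma word_degree_count: "word_degree w = count_list w LC + 2 * count_list w LD"
proof (induction w)
  case (Cons x w)
  thus ?case by (cases x) auto
qed simp

lemma count_list_replicate: "count_list (replicate k x) y = (if x = y then k else 0)"
  by (induction k) auto

text \<open>
  In the basis of the $\Omega_w$ the map is diagonal, and some coefficient of an eigenvector is
  not 0.
\<close>

lemma eigenvalue_word:
  assumes "eigenvector \<theta> c F" "F \<in> qs.span (\<Omega> ` W)" "finite W"
  shows "\<exists>w\<in>W. c = 2 ^ (count_list w LC + 1)"
proof -
  obtain u where "F = (\<Sum>v\<in>\<Omega> ` W. scale (u v) v)"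
    using assms(2,3) by (auto simp: qs.span_finite)
  hence F: "F = (\<Sum>w\<in>W. scale (u (\<Omega> w)) (\<Omega> w))"
    by (simp add: sum.reindex inj_on_subset[OF inj_\<Omega>])
  let ?e = "\<lambda>w. 2 ^ (count_list w LC + 1)"
  have "0 = \<theta> F - scale c F" using assms(1) by (simp add: eigenvector_def)
  also have "\<dots> = (\<Sum>w\<in>W. scale (u (\<Omega> w) * ?e w - c * u (\<Omega> w)) (\<Omega> w))"
    unfolding F by (simp add: \<theta>_linear \<theta>_\<Omega> qs.scale_sum_right sum_subtractf
        qs.scale_left_diff_distrib)
  finally have "u (\<Omega> w) * ?e w - c * u (\<Omega> w) = 0" if "w \<in> W" for w
    using \<Omega>_finite_combination_eq_0[where a = "\<lambda>w. u (\<Omega> w) * ?e w - c * u (\<Omega> w)",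
        OF assms(3) sym that] by blast
  hence *: "u (\<Omega> w) = 0 \<or> c = ?e w" if "w \<in> W" for w using that by (metis eq_iff_diff_eq_0
      mult.commute mult_cancel_left)
  have "\<exists>w\<in>W. u (\<Omega> w) \<noteq> 0"
  proof (rule ccontr)
    assume "\<not> ?thesis"
    hence "F = 0" unfolding F by (intro sum.neutral) auto
    thus False using assms(1) by (simp add: eigenvector_def)
  qed
  thus ?thesis using * by blast
qed

lemma eigenvalues_Peak_part:
  "{c. \<exists>f\<in>Peak_part (n + 1). eigenvector \<theta> c f} = {2 ^ (n + 1 - 2 * k) | k. k \<le> n div 2}"
proof (intro set_eqI iffI; clarify)
  fix c f assume "f \<in> Peak_part (n + 1)" "eigenvector \<theta> c f"
  then obtain w where w: "word_degree w = n" "c = 2 ^ (count_list w LC + 1)"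
    using eigenvalue_word[OF _ _ finite_words_degree] unfolding Peak_part_span[symmetric] by blast
  hence "count_list w LC + 1 = n + 1 - 2 * count_list w LD" "count_list w LD \<le> n div 2"
    using word_degree_count[of w] by auto
  thus "\<exists>k. c = 2 ^ (n + 1 - 2 * k) \<and> k \<le> n div 2" using w(2) by auto
next
  fix k assume k: "k \<le> n div 2"
  \<comment> \<open>The word ${\bf c}^{n-2k} {\bf d}^k$ realizes the eigenvalue.\<close>
  let ?w = "replicate (n - 2 * k) LC @ replicate k LD"
  have "count_list ?w LC = n - 2 * k" "count_list ?w LD = k"
    by (simp_all add: count_list_append count_list_replicate)
  hence "word_degree ?w = n" "n + 1 - 2 * k = count_list ?w LC + 1"
    using k word_degree_count[of ?w] by auto
  hence "\<Omega> ?w \<in> Peak_part (n + 1)" "eigenvector \<theta> (2 ^ (n + 1 - 2 * k)) (\<Omega> ?w)"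
    using eigenvector_\<Omega>[of ?w] unfolding Peak_part_span[symmetric] by (auto intro: qs.span_base)
  thus "\<exists>f\<in>Peak_part (n + 1). eigenvector \<theta> (2 ^ (n + 1 - 2 * k)) f" by blast
qed

theorem theorem3p1:
  shows "diagonalizable_on \<theta> Peak \<and>
    (\<forall>n. inj_on \<Omega> {w. word_degree w = n} \<and>
         qs.independent (\<Omega> ` {w. word_degree w = n}) \<and>
         qs.span (\<Omega> ` {w. word_degree w = n}) = Peak_part (n + 1)) \<and>
    (\<forall>w. eigenvector \<theta> (2 ^ (count_list w LC + 1)) (\<Omega> w)) \<and>
    (\<forall>n. {c. \<exists>f\<in>Peak_part (n + 1). eigenvector \<theta> c f} =
         {2 ^ (n + 1 - 2 * k) | k. k \<le> n div 2})"
proof (intro conjI allI)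
  fix n
  show "inj_on \<Omega> {w. word_degree w = n}" using inj_\<Omega> by (rule inj_on_subset) simp
  show "qs.independent (\<Omega> ` {w. word_degree w = n})"
    using independent_\<Omega> by (rule qs.independent_mono) auto
qed (rule diagonalizable_Peak Peak_part_span eigenvector_\<Omega> eigenvalues_Peak_part)+

end
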